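(* Let $R\ge0$ and let $\{e_i\}_{i\in I}$ be an absolute Schauder basis of $V$ consisting of homogeneous vectors, with coefficient functionals $\{\varphi^i\}_{i\in I}$. Then any choice of a maximal linearly independent subset of $\{e_{i_1}\cdots e_{i_n}\}_{n\in\mathbb{N}_0,\,i_1,\ldots,i_n\in I}$ gives an absolute Schauder basis of $\mathrm{S}^\bullet_R(V)$ and of $\mathcal{W}_{R^-}(V)$, with coefficient functionals given by the corresponding subset of $\{\varphi^{i_1}\cdots\varphi^{i_n}\}_{n\in\mathbb{N}_0,\,i_1,\ldots,i_n\in I}$. Moreover, whenever $p$ and $q$ are continuous seminorms on $V$ with $\sum_{i\in I}|\varphi^i(v)|\,p(e_i)\le q(v)$ for all $v\in V$, one has for all $v\in \mathrm{S}^\bullet_R(V)$ $$\sum_{n=0}^\infty\sum_{i_1,\ldots,i_n\in I}\left|(\varphi^{i_1}\cdots\varphi^{i_n})(v)\right|\,p_R(e_{i_1}\cdots e_{i_n})\le q_R(v).$$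
   Context: $\mathbb{K}=\mathbb{R}$ or $\mathbb{C}$, and $V=V_{\mathbf 0}\oplus V_{\mathbf 1}$ is a $\mathbb{Z}_2$-graded Hausdorff locally convex $\mathbb{K}$-vector space such that the projections onto $V_{\mathbf 0}$ and $V_{\mathbf 1}$ are continuous. A vector is homogeneous if it lies in $V_{\mathbf 0}$ (even) or in $V_{\mathbf 1}$ (odd). The symmetric group $S_n$ acts from the right on $V^{\otimes n}$ by $(v_1\otimes\cdots\otimes v_n)\triangleleft\sigma=\pm\, v_{\sigma(1)}\otimes\cdots\otimes v_{\sigma(n)}$ for homogeneous $v_i$, where $\pm$ is the Koszul sign ($-1$ to the number of pairs $i<j$ with $\sigma(i)>\sigma(j)$ and $v_{\sigma(i)},v_{\sigma(j)}$ both odd). Set $\mathcal{S}_n(v)=\frac1{n!}\sum_{\sigma\in S_n} v\triangleleft\sigma$, $\mathrm{S}^n(V)=\operatorname{im}\mathcal{S}_n\subseteq V^{\otimes n}$, $\mathrm{S}^0(V)=\mathbb{K}$, $\mathrm{S}^\bullet(V)=\bigoplus_n\mathrm{S}^n(V)\subseteq\mathrm{T}^\bullet(V)=\bigoplus_nV^{\otimes n}$, with product $vw=\mathcal{S}(v\otimes w)$, where $\mathcal{S}=\bigoplus_n\mathcal{S}_n$ and $\mathcal{S}_0=\mathrm{id}$. Thus $e_{i_1}\cdots e_{i_n}=\mathcal{S}_n(e_{i_1}\otimes\cdots\otimes e_{i_n})$ (for $n=0$ this is $1\in\mathbb{K}$, with the corresponding coefficient functional), and $\varphi^{i_1}\cdots\varphi^{i_n}=(\varphi^{i_1}\otimes\cdots\otimes\varphi^{i_n})\circ\mathcal{S}$,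 where $\varphi^{i_1}\otimes\cdots\otimes\varphi^{i_n}$ is extended by $0$ to tensor degrees different from $n$. For a continuous seminorm $p$ on $V$ let $p^n=p\otimes\cdots\otimes p$ be the projective tensor seminorm on $V^{\otimes n}$ ($p^0=|\cdot|$), and for $R\in\mathbb{R}$ set $p_R(v)=\sum_{n\ge0}p^n(v_n)\,n!^R$ for $v=\sum_nv_n$, $v_n\in V^{\otimes n}$. $\mathrm{S}^\bullet_R(V)$ (which is also the locally convex space underlying the Weyl algebra $\mathcal{W}_R(V)$) is $\mathrm{S}^\bullet(V)$ with the locally convex topology of all $p_R$, $p$ a continuous seminorm on $V$. $\mathcal{W}_{R^-}(V)$ is $\mathrm{S}^\bullet(V)$ with the locally convex topology of all $p_{R-\epsilon}$, $\epsilon>0$, $p$ a continuous seminorm on $V$. An absolute Schauder basis of a locally convex space $W$ is a linearly independent family $\{e_i\}_{i\in I}$ (with $I$ an arbitrary index set) together with continuous linear functionals $\{\varphi^i\}_{i\in I}$, called the coefficient functionals, with $\varphi^i(e_j)=\delta^i_j$ such that $v=\sum_{i\in I}\varphi^i(v)e_i$ converges for all $v\in W$ and for every continuous seminorm $p$ on $W$ there is a continuous seminorm $q$ on $W$ with $\sum_{i\in I}|\varphi^i(v)|p(e_i)\le q(v)$ for all $v\in W$.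
   Formalization: The coefficient functionals are the products φ^{i_1}⋯φ^{i_n} divided by their value at e_{i_1}⋯e_{i_n}; unnormalised they fail φ^i(e_j)=δ, e.g. (φ^1φ^2)(e_1e_2)=1/2 for distinct even e_1,e_2. The final inequality uses the unnormalised ones. *)

theory Defs
  imports
    "HOL-Analysis.Analysis"
    "HOL-Combinatorics.Permutations"
    "HOL-Library.Function_Algebras"
begin

section \<open>Locally convex spaces and absolute Schauder bases\<close>

text \<open>
  The scalars are an arbitrary real normed field: by the Gelfand-Mazur theorem such a field is
  isometrically isomorphic to the reals or to the complex numbers, so this is exactly the case
  distinction between real and complex scalars.  A vector space is a type together with an
  explicit scalar multiplication.
\<close>

locale locally_convex_space = vector_space smul
  for smul :: "'k::real_normed_field \<Rightarrow> 'v::ab_group_add \<Rightarrow> 'v" +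
  fixes T :: "'v topology"
  assumes topspace_UNIV: "topspace T = UNIV"
    and Hausdorff: "Hausdorff_space T"
    and continuous_add: "continuous_map (prod_topology T T) T (\<lambda>(x, y). x + y)"
    and continuous_scale: "continuous_map (prod_topology euclidean T) T (\<lambda>(a, x). smul a x)"
    and locally_convex: "\<And>U. openin T U \<Longrightarrow> 0 \<in> U \<Longrightarrow>
      \<exists>C. openin T C \<and> 0 \<in> C \<and> C \<subseteq> U \<and>
        (\<forall>x\<in>C. \<forall>y\<in>C. \<forall>t\<in>{0..1}. smul (of_real (1 - t)) x + smul (of_real t) y \<in> C)"

definition projection_along :: "'v::ab_group_add set \<Rightarrow> 'v set \<Rightarrow> 'v \<Rightarrow> 'v" where
  "projection_along A B v = (THE a. a \<in> A \<and> v - a \<in> B)"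

locale graded_locally_convex_space = locally_convex_space smul T
  for smul :: "'k::real_normed_field \<Rightarrow> 'v::ab_group_add \<Rightarrow> 'v" and T +
  fixes V0 V1 :: "'v set"
  assumes subspace_even: "subspace V0"
    and subspace_odd: "subspace V1"
    and disjoint: "V0 \<inter> V1 = {0}"
    and decompose: "\<And>v. \<exists>a\<in>V0. \<exists>b\<in>V1. v = a + b"
    and continuous_even: "continuous_map T T (projection_along V0 V1)"
    and continuous_odd: "continuous_map T T (projection_along V1 V0)"

text \<open>
  In the following definitions the topological vector space is the carrier \<^term>\<open>topspace T\<close>,
  a linear subspace of the ambient type.
\<close>

definition continuous_seminorm ::
  "('k::real_normed_field \<Rightarrow> 'w::ab_group_add \<Rightarrow> 'w) \<Rightarrow> 'w topology \<Rightarrow> ('w \<Rightarrow> real) \<Rightarrow> bool" where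
  "continuous_seminorm smul T p \<longleftrightarrow>
     (\<forall>x\<in>topspace T. \<forall>y\<in>topspace T. p (x + y) \<le> p x + p y) \<and>
     (\<forall>c. \<forall>x\<in>topspace T. p (smul c x) = norm c * p x) \<and>
     continuous_map T euclidean p"

definition continuous_functional ::
  "('k::real_normed_field \<Rightarrow> 'w::ab_group_add \<Rightarrow> 'w) \<Rightarrow> 'w topology \<Rightarrow> ('w \<Rightarrow> 'k) \<Rightarrow> bool" where
  "continuous_functional smul T f \<longleftrightarrow>
     (\<forall>x\<in>topspace T. \<forall>y\<in>topspace T. f (x + y) = f x + f y) \<and>
     (\<forall>c. \<forall>x\<in>topspace T. f (smul c x) = c * f x) \<and>
     continuous_map T euclidean f"

definition absolute_estimate ::
  "'w set \<Rightarrow> 'i set \<Rightarrow> ('i \<Rightarrow> 'w) \<Rightarrow> ('i \<Rightarrow> 'w \<Rightarrow> 'k::real_normed_field) \<Rightarrow>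
   ('w \<Rightarrow> real) \<Rightarrow> ('w \<Rightarrow> real) \<Rightarrow> bool" where
  "absolute_estimate W I e \<phi> p q \<longleftrightarrow>
     (\<forall>v\<in>W. (\<lambda>i. norm (\<phi> i v) * p (e i)) summable_on I \<and>
            (\<Sum>\<^sub>\<infinity>i\<in>I. norm (\<phi> i v) * p (e i)) \<le> q v)"

text \<open>The expansion converges as a net over the finite subsets of the index set.\<close>

definition absolute_schauder_basis ::
  "('k::real_normed_field \<Rightarrow> 'w::ab_group_add \<Rightarrow> 'w) \<Rightarrow> 'w topology \<Rightarrow>
   'i set \<Rightarrow> ('i \<Rightarrow> 'w) \<Rightarrow> ('i \<Rightarrow> 'w \<Rightarrow> 'k) \<Rightarrow> bool" where
  "absolute_schauder_basis smul T I e \<phi> \<longleftrightarrow>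
     e ` I \<subseteq> topspace T \<and>
     inj_on e I \<and> \<not> module.dependent smul (e ` I) \<and>
     (\<forall>i\<in>I. continuous_functional smul T (\<phi> i)) \<and>
     (\<forall>i\<in>I. \<forall>j\<in>I. \<phi> i (e j) = (if i = j then 1 else 0)) \<and>
     (\<forall>v\<in>topspace T. limitin T (\<lambda>F. \<Sum>i\<in>F. smul (\<phi> i v) (e i)) v (finite_subsets_at_top I)) \<and>
     (\<forall>p. continuous_seminorm smul T p \<longrightarrow>
        (\<exists>q. continuous_seminorm smul T q \<and> absolute_estimate (topspace T) I e \<phi> p q))"

definition maximal_independent ::
  "('k::field \<Rightarrow> 'w::ab_group_add \<Rightarrow> 'w) \<Rightarrow> 'w set \<Rightarrow> 'w set \<Rightarrow> bool" where
  "maximal_independent smul A B \<longleftrightarrow>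
     B \<subseteq> A \<and> \<not> module.dependent smul B \<and>
     (\<forall>C. B \<subseteq> C \<and> C \<subseteq> A \<and> \<not> module.dependent smul C \<longrightarrow> C = B)"

definition seminorm_topology ::
  "'w::ab_group_add set \<Rightarrow> ('w \<Rightarrow> real) set \<Rightarrow> 'w topology" where
  "seminorm_topology W P =
     topology_generated_by (insert W {{y\<in>W. p (y - x) < r} | p x r. p \<in> P \<and> x \<in> W \<and> 0 < r})"


section \<open>Tensor powers\<close>

text \<open>
  The algebraic tensor power of degree \<open>n\<close> is realised inside the dual of the space of
  \<open>n\<close>-linear forms: a pure tensor is the evaluation of such forms at a list of \<open>n\<close> vectors.
  The lemmas \<open>multilinear_tens\<close> and \<open>tensor_power_universal\<close> show that this
  realisation has the universal property.  In degree \<open>0\<close> it is the line spanned by the tensor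
  \<open>tens smul []\<close>, which plays the role of the unit of the scalar field.
\<close>

type_synonym ('k, 'v) tensor = "('v list \<Rightarrow> 'k) \<Rightarrow> 'k"

definition multilinear ::
  "('k::field \<Rightarrow> 'v::ab_group_add \<Rightarrow> 'v) \<Rightarrow> ('k \<Rightarrow> 'w::ab_group_add \<Rightarrow> 'w) \<Rightarrow>
   nat \<Rightarrow> ('v list \<Rightarrow> 'w) \<Rightarrow> bool" where
  "multilinear s t n g \<longleftrightarrow>
     (\<forall>vs i. length vs = n \<longrightarrow> i < n \<longrightarrow> Vector_Spaces.linear s t (\<lambda>x. g (vs[i := x])))"

definition tscale :: "'k::field \<Rightarrow> ('k, 'v) tensor \<Rightarrow> ('k, 'v) tensor" where
  "tscale c X = (\<lambda>M. c * X M)"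

definition tens ::
  "('k::field \<Rightarrow> 'v::ab_group_add \<Rightarrow> 'v) \<Rightarrow> 'v list \<Rightarrow> ('k, 'v) tensor" where
  "tens smul vs = (\<lambda>M. if multilinear smul (*) (length vs) M then M vs else 0)"

definition tensor_power ::
  "('k::field \<Rightarrow> 'v::ab_group_add \<Rightarrow> 'v) \<Rightarrow> nat \<Rightarrow> ('k, 'v) tensor set" where
  "tensor_power smul n = module.span tscale {tens smul vs | vs. length vs = n}"

lemma vector_space_tscale: "vector_space (tscale :: 'k::field \<Rightarrow> ('k, 'v) tensor \<Rightarrow> ('k, 'v) tensor)"
  by unfold_locales (auto simp: tscale_def fun_eq_iff algebra_simps)

lemma vector_space_times: "vector_space ((*) :: 'k::field \<Rightarrow> 'k \<Rightarrow> 'k)"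
  by unfold_locales (auto simp: algebra_simps)

lemma multilinear_tens:
  assumes "vector_space smul"
  shows "multilinear smul tscale n (tens smul)"
proof -
  interpret V: vector_space smul by fact
  interpret W: vector_space "tscale :: 'a \<Rightarrow> ('a, 'b) tensor \<Rightarrow> _" by (rule vector_space_tscale)
  have add: "M (vs[i := x + y]) = M (vs[i := x]) + M (vs[i := y])"
    and scl: "M (vs[i := smul c x]) = c * M (vs[i := x])"
    if "multilinear smul (*) (length vs) M" "i < length vs" for M vs i x y c
  proof -
    interpret L: Vector_Spaces.linear smul "(*)" "\<lambda>x. M (vs[i := x])"
      using that by (auto simp: multilinear_def)
    show "M (vs[i := x + y]) = M (vs[i := x]) + M (vs[i := y])" by (rule L.add)
    show "M (vs[i := smul c x]) = c * M (vs[i := x])" by (rule L.scale)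
  qed
  show ?thesis
    unfolding multilinear_def
  proof (intro allI impI)
    fix vs :: "'b list" and i
    assume "length vs = n" "i < n"
    then show "Vector_Spaces.linear smul tscale (\<lambda>x. tens smul (vs[i := x]))"
      by unfold_locales (auto simp: tens_def tscale_def fun_eq_iff add scl)
  qed
qed

text \<open>
  Every multilinear map factors through the pure tensors; the factorisation is unique on
  \<^term>\<open>tensor_power smul n\<close> because the pure tensors span.
\<close>

lemma tensor_power_universal:
  fixes smul :: "'k::field \<Rightarrow> 'v::ab_group_add \<Rightarrow> 'v" and t :: "'k \<Rightarrow> 'u::ab_group_add \<Rightarrow> 'u"
  assumes "vector_space smul" "vector_space t" and g: "multilinear smul t n g"
  shows "\<exists>f. Vector_Spaces.linear tscale t f \<and> (\<forall>vs. length vs = n \<longrightarrow> f (tens smul vs) = g vs)"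
proof -
  interpret K: vector_space "(*) :: 'k \<Rightarrow> _" by (rule vector_space_times)
  interpret W: vector_space "tscale :: 'k \<Rightarrow> ('k, 'v) tensor \<Rightarrow> _" by (rule vector_space_tscale)
  interpret U: vector_space t by fact
  interpret WU: vector_space_pair "tscale :: 'k \<Rightarrow> ('k, 'v) tensor \<Rightarrow> _" t ..
  interpret UK: vector_space_pair t "(*) :: 'k \<Rightarrow> _" ..
  let ?A = "{tens smul vs | vs. length vs = n}"
  obtain B where B: "B \<subseteq> ?A" "W.independent B" "?A \<subseteq> W.span B"
    by (rule W.maximal_independent_subset)
  obtain r where r: "length (r b) = n \<and> tens smul (r b) = b" if "b \<in> B" for b
    using B(1) by (subgoal_tac "\<forall>b. \<exists>vs. b \<in> B \<longrightarrow> length vs = n \<and> tens smul vs = b") (metis, blast)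
  obtain f where f: "Vector_Spaces.linear tscale t f" "\<And>b. b \<in> B \<Longrightarrow> f b = g (r b)"
    using WU.linear_independent_extend[OF B(2), of "\<lambda>b. g (r b)"] by auto
  have "f (tens smul vs) = g vs" if vs: "length vs = n" for vs
  proof (rule ccontr)
    define u where "u = f (tens smul vs) - g vs"
    assume "f (tens smul vs) \<noteq> g vs"
    then have "U.independent {u}" by (simp add: u_def)
    from UK.linear_independent_extend[OF this, of "\<lambda>_. 1"]
    obtain \<xi> where \<xi>: "Vector_Spaces.linear t (*) \<xi>" "\<xi> u = 1" by auto
    have M: "multilinear smul (*) n (\<lambda>ws. \<xi> (g ws))"
      unfolding multilinear_def
    proof (intro allI impI)
      fix ws :: "'v list" and i
      assume "length ws = n" "i < n"
      then have "Vector_Spaces.linear smul t (\<lambda>x. g (ws[i := x]))"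
        using g by (simp add: multilinear_def)
      from Vector_Spaces.linear_compose[OF this \<xi>(1)]
      show "Vector_Spaces.linear smul (*) (\<lambda>x. \<xi> (g (ws[i := x])))" by (simp add: o_def)
    qed
    have ev: "Vector_Spaces.linear tscale (*) (\<lambda>X :: ('k, 'v) tensor. X (\<lambda>ws. \<xi> (g ws)))"
      by unfold_locales (auto simp: tscale_def algebra_simps)
    have \<xi>f: "Vector_Spaces.linear tscale (*) (\<lambda>X. \<xi> (f X))"
      using Vector_Spaces.linear_compose[OF f(1) \<xi>(1)] by (simp add: o_def)
    interpret WK: vector_space_pair "tscale :: 'k \<Rightarrow> ('k, 'v) tensor \<Rightarrow> _" "(*) :: 'k \<Rightarrow> _" ..
    have "\<xi> (f (tens smul vs)) = tens smul vs (\<lambda>ws. \<xi> (g ws))"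
    proof (rule WK.linear_eq_on[OF \<xi>f ev])
      show "tens smul vs \<in> W.span B" using B(3) vs by blast
      fix b assume b: "b \<in> B"
      have "b (\<lambda>ws. \<xi> (g ws)) = tens smul (r b) (\<lambda>ws. \<xi> (g ws))" using r[OF b] by simp
      then show "\<xi> (f b) = b (\<lambda>ws. \<xi> (g ws))" using r[OF b] f(2)[OF b] M by (simp add: tens_def)
    qed
    then have "\<xi> u = 0"
      using vs M module_hom.diff[OF Vector_Spaces.linear.axioms(3)[OF \<xi>(1)]]
      by (simp add: u_def tens_def)
    with \<xi>(2) show False by simp
  qed
  with f(1) show ?thesis by blast
qed

text \<open>
  The projective seminorm \<open>p \<otimes> \<dots> \<otimes> p\<close>.  The coefficients \<open>c\<close> can be absorbed into the
  vectors unless \<open>n = 0\<close>, where they make the seminorm the absolute value.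
\<close>

definition tensor_seminorm ::
  "('k::real_normed_field \<Rightarrow> 'v::ab_group_add \<Rightarrow> 'v) \<Rightarrow> nat \<Rightarrow> ('v \<Rightarrow> real) \<Rightarrow>
   ('k, 'v) tensor \<Rightarrow> real" where
  "tensor_seminorm smul n p X =
     Inf {(\<Sum>(c, vs)\<leftarrow>xs. norm c * prod_list (map p vs)) | xs.
            (\<forall>(c, vs)\<in>set xs. length vs = n) \<and> X = (\<Sum>(c, vs)\<leftarrow>xs. tscale c (tens smul vs))}"


section \<open>The symmetric algebra\<close>

text \<open>
  The Koszul sign of a permutation at a list of homogeneous vectors.  It depends on the convention
  that the zero vector counts as odd, but then the tensor carrying the sign vanishes.
\<close>

definition koszul_sign :: "'v set \<Rightarrow> (nat \<Rightarrow> nat) \<Rightarrow> 'v list \<Rightarrow> 'k::field" where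
  "koszul_sign V1 \<sigma> vs =
     (-1) ^ card {(i, j). i < j \<and> j < length vs \<and> \<sigma> i > \<sigma> j \<and> vs ! \<sigma> i \<in> V1 \<and> vs ! \<sigma> j \<in> V1}"

text \<open>
  The action of a permutation on tensors of degree \<open>n\<close>, as the linear map with the prescribed
  values on tensors of homogeneous vectors; those span, so on \<^term>\<open>tensor_power smul n\<close> there is
  only one such map; existence is \<open>is_tensor_act_tensor_act\<close>.
\<close>

definition is_tensor_act ::
  "('k::field \<Rightarrow> 'v::ab_group_add \<Rightarrow> 'v) \<Rightarrow> 'v set \<Rightarrow> 'v set \<Rightarrow> nat \<Rightarrow> (nat \<Rightarrow> nat) \<Rightarrow>
   (('k, 'v) tensor \<Rightarrow> ('k, 'v) tensor) \<Rightarrow> bool" where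
  "is_tensor_act smul V0 V1 n \<sigma> f \<longleftrightarrow>
     Vector_Spaces.linear tscale tscale f \<and>
     (\<forall>vs. length vs = n \<and> set vs \<subseteq> V0 \<union> V1 \<longrightarrow>
        f (tens smul vs) = tscale (koszul_sign V1 \<sigma> vs) (tens smul (permute_list \<sigma> vs)))"

definition tensor_act ::
  "('k::field \<Rightarrow> 'v::ab_group_add \<Rightarrow> 'v) \<Rightarrow> 'v set \<Rightarrow> 'v set \<Rightarrow> nat \<Rightarrow> (nat \<Rightarrow> nat) \<Rightarrow>
   ('k, 'v) tensor \<Rightarrow> ('k, 'v) tensor" where
  "tensor_act smul V0 V1 n \<sigma> = (SOME f. is_tensor_act smul V0 V1 n \<sigma> f)"

lemma (in graded_locally_convex_space) projection_along_props:
  shows "Vector_Spaces.linear smul smul (projection_along V0 V1)"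
    and "Vector_Spaces.linear smul smul (projection_along V1 V0)"
    and "v \<in> V0 \<Longrightarrow> projection_along V0 V1 v = v" "v \<in> V1 \<Longrightarrow> projection_along V0 V1 v = 0"
    and "v \<in> V1 \<Longrightarrow> projection_along V1 V0 v = v" "v \<in> V0 \<Longrightarrow> projection_along V1 V0 v = 0"
proof -
  have uniq: "projection_along A B (a + b) = a"
    if "subspace A" "subspace B" "A \<inter> B = {0}" "a \<in> A" "b \<in> B" for A B a b
    unfolding projection_along_def
  proof (rule the_equality)
    show "a \<in> A \<and> a + b - a \<in> B" using that by simp
    fix a' assume a': "a' \<in> A \<and> a + b - a' \<in> B"
    have "a' - a \<in> A" using a' that by (simp add: subspace_diff)
    moreover have "b - (a + b - a') \<in> B" using a' that by (blast intro: subspace_diff)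
    then have "a' - a \<in> B" by (simp add: algebra_simps)
    ultimately have "a' - a \<in> A \<inter> B" by blast
    then show "a' = a" unfolding that(3) by simp
  qed
  have lin: "Vector_Spaces.linear smul smul (projection_along A B)"
    if AB: "subspace A" "subspace B" "A \<inter> B = {0}" and dec: "\<And>v. \<exists>a\<in>A. \<exists>b\<in>B. v = a + b" for A B
  proof unfold_locales
    fix x y c
    obtain a b a' b' where *: "a \<in> A" "b \<in> B" "x = a + b" "a' \<in> A" "b' \<in> B" "y = a' + b'"
      using dec by metis
    have "projection_along A B ((a + a') + (b + b')) = a + a'"
      by (rule uniq[OF AB subspace_add[OF AB(1) *(1,4)] subspace_add[OF AB(2) *(2,5)]])
    then show "projection_along A B (x + y) = projection_along A B x + projection_along A B y"
      using uniq[OF AB *(1,2)] uniq[OF AB *(4,5)] *(3,6) by (simp add: ac_simps)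
    have "projection_along A B (smul c a + smul c b) = smul c a"
      by (rule uniq[OF AB subspace_scale[OF AB(1) *(1)] subspace_scale[OF AB(2) *(2)]])
    then show "projection_along A B (smul c x) = smul c (projection_along A B x)"
      using uniq[OF AB *(1,2)] *(3) by (simp add: scale_right_distrib)
  qed
  note sub = subspace_even subspace_odd
  have disjoint': "V1 \<inter> V0 = {0}" using disjoint by blast
  have decompose': "\<exists>a\<in>V1. \<exists>b\<in>V0. v = a + b" for v
    using decompose[of v] by (metis add.commute)
  show "Vector_Spaces.linear smul smul (projection_along V0 V1)"
    using lin sub disjoint decompose by blast
  show "Vector_Spaces.linear smul smul (projection_along V1 V0)"
    using lin sub disjoint' decompose' by blast
  show "v \<in> V0 \<Longrightarrow> projection_along V0 V1 v = v"
    using uniq[OF sub disjoint, of v 0] subspace_0[OF sub(2)] by simp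
  show "v \<in> V1 \<Longrightarrow> projection_along V0 V1 v = 0"
    using uniq[OF sub disjoint, of 0 v] subspace_0[OF sub(1)] by simp
  show "v \<in> V1 \<Longrightarrow> projection_along V1 V0 v = v"
    using uniq[OF sub(2,1) disjoint', of v 0] subspace_0[OF sub(1)] by simp
  show "v \<in> V0 \<Longrightarrow> projection_along V1 V0 v = 0"
    using uniq[OF sub(2,1) disjoint', of 0 v] subspace_0[OF sub(2)] by simp
qed

lemma (in graded_locally_convex_space) is_tensor_act_tensor_act:
  assumes \<sigma>: "\<sigma> permutes {..<n}"
  shows "is_tensor_act smul V0 V1 n \<sigma> (tensor_act smul V0 V1 n \<sigma>)"
proof -
  interpret W: vector_space "tscale :: 'k \<Rightarrow> ('k, 'v) tensor \<Rightarrow> _" by (rule vector_space_tscale)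
  interpret VW: vector_space_pair smul "tscale :: 'k \<Rightarrow> ('k, 'v) tensor \<Rightarrow> _" ..
  define P where "P D i = (if i \<in> D then projection_along V1 V0 else projection_along V0 V1)"
    for D :: "nat set" and i
  define sgn :: "nat set \<Rightarrow> 'k" where
    "sgn D = (-1) ^ card {(i, j). i < j \<and> j < n \<and> \<sigma> i > \<sigma> j \<and> \<sigma> i \<in> D \<and> \<sigma> j \<in> D}" for D
  define w where "w D vs = permute_list \<sigma> (map (\<lambda>i. P D i (vs ! i)) [0..<n])" for D vs
  define g where "g vs = (\<Sum>D\<in>Pow {..<n}. tscale (sgn D) (tens smul (w D vs)))" for vs
  have linP: "Vector_Spaces.linear smul smul (P D i)" for D i
    using projection_along_props(1,2) by (simp add: P_def)
  have "multilinear smul tscale n g"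
    unfolding multilinear_def
  proof (intro allI impI)
    fix vs :: "'v list" and i
    assume len: "length vs = n" and i: "i < n"
    define k where "k = inv \<sigma> i"
    have k: "k < n" and \<sigma>k: "\<sigma> k = i"
      using \<sigma> i permutes_in_image[OF permutes_inv[OF \<sigma>], of i] permutes_inverses(1)[OF \<sigma>]
      by (auto simp: k_def)
    have upd: "w D (vs[i := x]) = (w D vs)[k := P D i x]" for D x
    proof (rule nth_equalityI)
      fix l assume "l < length (w D (vs[i := x]))"
      then have l: "l < n" by (simp add: w_def permute_list_def)
      have "\<sigma> l < n" using permutes_in_image[OF \<sigma>, of l] l by auto
      moreover have "\<sigma> l = i \<longleftrightarrow> l = k" using permutes_inj[OF \<sigma>] \<sigma>k by (metis injD)
      ultimately show "w D (vs[i := x]) ! l = (w D vs)[k := P D i x] ! l"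
        using l len i by (auto simp: w_def permute_list_def nth_list_update)
    qed (simp add: w_def permute_list_def)
    have "Vector_Spaces.linear smul tscale (\<lambda>x. tens smul (w D (vs[i := x])))" for D
    proof -
      have "length (w D vs) = n" by (simp add: w_def permute_list_def)
      then have "Vector_Spaces.linear smul tscale (\<lambda>y. tens smul ((w D vs)[k := y]))"
        using multilinear_tens[OF vector_space_axioms, of n] k by (auto simp: multilinear_def)
      from Vector_Spaces.linear_compose[OF linP this] show ?thesis by (simp add: upd o_def)
    qed
    then show "Vector_Spaces.linear smul tscale (\<lambda>x. g (vs[i := x]))"
      unfolding g_def
      by (intro VW.linear_compose_sum ballI VW.linear_compose_scale_right) auto
  qed
  from tensor_power_universal[OF vector_space_axioms vector_space_tscale this]
  obtain f where f: "Vector_Spaces.linear tscale tscale f"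
    "\<And>vs. length vs = n \<Longrightarrow> f (tens smul vs) = g vs" by blast
  have tens0: "tens smul vs = 0" if "i < length vs" "vs ! i = 0" for vs and i
  proof -
    have "Vector_Spaces.linear smul tscale (\<lambda>x. tens smul (vs[i := x]))"
      using multilinear_tens[OF vector_space_axioms, of "length vs"] that by (auto simp: multilinear_def)
    from VW.linear_0[OF this] show ?thesis using that by (metis list_update_id)
  qed
  have "g vs = tscale (koszul_sign V1 \<sigma> vs) (tens smul (permute_list \<sigma> vs))"
    if len: "length vs = n" and hom: "set vs \<subseteq> V0 \<union> V1" for vs
  proof -
    let ?D = "{i. i < n \<and> vs ! i \<in> V1}"
    have "w D vs ! inv \<sigma> i = 0 \<and> inv \<sigma> i < length (w D vs)"
      if "i < n" "i \<in> D \<longleftrightarrow> i \<notin> ?D" for D i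
    proof -
      have k: "inv \<sigma> i < n" "\<sigma> (inv \<sigma> i) = i"
        using permutes_in_image[OF permutes_inv[OF \<sigma>], of i] permutes_inverses(1)[OF \<sigma>] that by auto
      have "vs ! i \<in> V0 \<union> V1" using hom len that by (meson nth_mem subsetD)
      then have "P D i (vs ! i) = 0"
        using that projection_along_props(4,6) by (auto simp: P_def)
      with k that show ?thesis by (simp add: w_def permute_list_def)
    qed
    then have zero: "tens smul (w D vs) = 0" if "i < n" "i \<in> D \<longleftrightarrow> i \<notin> ?D" for D i
      using tens0 that by blast
    have "tens smul (w D vs) = 0" if D: "D \<in> Pow {..<n} - {?D}" for D
    proof -
      have "\<exists>i. i < n \<and> (i \<in> D \<longleftrightarrow> i \<notin> ?D)"
      proof (rule ccontr)
        assume "\<not> ?thesis"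
        then have "D = ?D" using D by auto
        with D show False by simp
      qed
      then show ?thesis using zero by blast
    qed
    then have "g vs = tscale (sgn ?D) (tens smul (w ?D vs))"
      unfolding g_def by (subst sum.remove[of _ ?D]) (auto intro!: sum.neutral)
    moreover have "map (\<lambda>i. P ?D i (vs ! i)) [0..<n] = vs"
    proof (rule nth_equalityI)
      fix i assume "i < length (map (\<lambda>i. P ?D i (vs ! i)) [0..<n])"
      then have i: "i < n" by simp
      then have "vs ! i \<in> V0 \<union> V1" using hom len by (meson nth_mem subsetD)
      then show "map (\<lambda>i. P ?D i (vs ! i)) [0..<n] ! i = vs ! i"
        using i projection_along_props(3,5) by (auto simp: P_def)
    qed (simp add: len)
    moreover have "sgn ?D = koszul_sign V1 \<sigma> vs"
    proof -
      have "\<sigma> i < n" if "i < n" for i using permutes_in_image[OF \<sigma>, of i] that by auto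
      then have "{(i, j). i < j \<and> j < n \<and> \<sigma> i > \<sigma> j \<and> \<sigma> i \<in> ?D \<and> \<sigma> j \<in> ?D} =
        {(i, j). i < j \<and> j < length vs \<and> \<sigma> i > \<sigma> j \<and> vs ! \<sigma> i \<in> V1 \<and> vs ! \<sigma> j \<in> V1}"
        using len by auto
      then show ?thesis by (simp add: sgn_def koszul_sign_def)
    qed
    ultimately show ?thesis by (simp add: w_def)
  qed
  with f have "is_tensor_act smul V0 V1 n \<sigma> f" by (simp add: is_tensor_act_def)
  then show ?thesis unfolding tensor_act_def by (rule someI[where P = "is_tensor_act smul V0 V1 n \<sigma>"])
qed

definition symmetrizer ::
  "('k::field_char_0 \<Rightarrow> 'v::ab_group_add \<Rightarrow> 'v) \<Rightarrow> 'v set \<Rightarrow> 'v set \<Rightarrow> nat \<Rightarrow>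
   ('k, 'v) tensor \<Rightarrow> ('k, 'v) tensor" where
  "symmetrizer smul V0 V1 n X =
     tscale (1 / fact n) (\<Sum>\<sigma> | \<sigma> permutes {..<n}. tensor_act smul V0 V1 n \<sigma> X)"

definition sym_power ::
  "('k::field_char_0 \<Rightarrow> 'v::ab_group_add \<Rightarrow> 'v) \<Rightarrow> 'v set \<Rightarrow> 'v set \<Rightarrow> nat \<Rightarrow> ('k, 'v) tensor set" where
  "sym_power smul V0 V1 n = symmetrizer smul V0 V1 n ` tensor_power smul n"

text \<open>Elements of the direct sum are sequences with finite support.\<close>

type_synonym ('k, 'v) tensors = "nat \<Rightarrow> ('k, 'v) tensor"

definition sscale :: "'k::field \<Rightarrow> ('k, 'v) tensors \<Rightarrow> ('k, 'v) tensors" where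
  "sscale c v = (\<lambda>n. tscale c (v n))"

definition sym_algebra ::
  "('k::field_char_0 \<Rightarrow> 'v::ab_group_add \<Rightarrow> 'v) \<Rightarrow> 'v set \<Rightarrow> 'v set \<Rightarrow> ('k, 'v) tensors set" where
  "sym_algebra smul V0 V1 = {v. finite {n. v n \<noteq> 0} \<and> (\<forall>n. v n \<in> sym_power smul V0 V1 n)}"

text \<open>
  A word \<open>u = [i\<^sub>1, \<dots>, i\<^sub>n]\<close> gives the monomial
  \<open>e i\<^sub>1 \<cdots> e i\<^sub>n = S\<^sub>n (e i\<^sub>1 \<otimes> \<dots> \<otimes> e i\<^sub>n)\<close> and the functional
  \<open>\<phi> i\<^sub>1 \<cdots> \<phi> i\<^sub>n = (\<phi> i\<^sub>1 \<otimes> \<dots> \<otimes> \<phi> i\<^sub>n) \<circ> S\<close>.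
  Since tensors are functionals on multilinear forms, the tensor product of the functionals
  \<open>\<phi> i\<^sub>k\<close> is the evaluation at the form \<open>[x\<^sub>1, \<dots>, x\<^sub>n] \<mapsto> \<phi> i\<^sub>1 x\<^sub>1 \<cdots> \<phi> i\<^sub>n x\<^sub>n\<close>.
  The value of the functional of \<open>u\<close> at a nonzero monomial of \<open>u\<close> is not \<open>1\<close> in general
  but \<open>\<Prod>\<^sub>i m\<^sub>i! / n!\<close>, with \<open>m\<^sub>i\<close> the multiplicity of \<open>i\<close> in \<open>u\<close>, so the dual family is
  obtained by dividing by this value.
\<close>

definition sym_monomial ::
  "('k::field_char_0 \<Rightarrow> 'v::ab_group_add \<Rightarrow> 'v) \<Rightarrow> 'v set \<Rightarrow> 'v set \<Rightarrow> ('i \<Rightarrow> 'v) \<Rightarrow> 'i list \<Rightarrow>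
   ('k, 'v) tensors" where
  "sym_monomial smul V0 V1 e u =
     (\<lambda>n. if n = length u then symmetrizer smul V0 V1 n (tens smul (map e u)) else 0)"

definition tensor_functional :: "('i \<Rightarrow> 'v \<Rightarrow> 'k::field) \<Rightarrow> 'i list \<Rightarrow> ('k, 'v) tensor \<Rightarrow> 'k" where
  "tensor_functional \<phi> u X = X (\<lambda>xs. prod_list (map2 \<phi> u xs))"

definition sym_functional ::
  "('k::field_char_0 \<Rightarrow> 'v::ab_group_add \<Rightarrow> 'v) \<Rightarrow> 'v set \<Rightarrow> 'v set \<Rightarrow> ('i \<Rightarrow> 'v \<Rightarrow> 'k) \<Rightarrow> 'i list \<Rightarrow>
   ('k, 'v) tensors \<Rightarrow> 'k" where
  "sym_functional smul V0 V1 \<phi> u v =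
     tensor_functional \<phi> u (symmetrizer smul V0 V1 (length u) (v (length u)))"

definition weighted_seminorm ::
  "('k::real_normed_field \<Rightarrow> 'v::ab_group_add \<Rightarrow> 'v) \<Rightarrow> ('v \<Rightarrow> real) \<Rightarrow> real \<Rightarrow>
   ('k, 'v) tensors \<Rightarrow> real" where
  "weighted_seminorm smul p R v =
     (\<Sum>n | v n \<noteq> 0. tensor_seminorm smul n p (v n) * fact n powr R)"

definition sym_topology ::
  "('k::real_normed_field \<Rightarrow> 'v::ab_group_add \<Rightarrow> 'v) \<Rightarrow> 'v topology \<Rightarrow> 'v set \<Rightarrow> 'v set \<Rightarrow> real \<Rightarrow>
   ('k, 'v) tensors topology" where
  "sym_topology smul T V0 V1 R =
     seminorm_topology (sym_algebra smul V0 V1)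
       {weighted_seminorm smul p R | p. continuous_seminorm smul T p}"

definition weyl_minus_topology ::
  "('k::real_normed_field \<Rightarrow> 'v::ab_group_add \<Rightarrow> 'v) \<Rightarrow> 'v topology \<Rightarrow> 'v set \<Rightarrow> 'v set \<Rightarrow> real \<Rightarrow>
   ('k, 'v) tensors topology" where
  "weyl_minus_topology smul T V0 V1 R =
     seminorm_topology (sym_algebra smul V0 V1)
       {weighted_seminorm smul p (R - \<epsilon>) | p \<epsilon>. continuous_seminorm smul T p \<and> 0 < \<epsilon>}"

end

theory Submission
  imports Defs
begin

text \<open>
  Let \<open>a u = |(\<phi> u)(v)| p\<^sub>R(e u)\<close> for a word \<open>u\<close> in the index set, where \<open>e u\<close> is the monomial of
  \<open>u\<close> and \<open>\<phi> u\<close> its functional.  Everything rests on the estimate of the sum of \<open>a\<close> over all words by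
  \<open>q\<^sub>R(v)\<close> (\<open>word_estimate\<close>, \<open>all_words_estimate\<close>).  On a pure tensor \<open>x\<^sub>1 \<otimes> \<dots> \<otimes> x\<^sub>n\<close> the sum over
  the words of length \<open>n\<close> of \<open>\<Prod>\<^sub>k |\<phi> i\<^sub>k (x\<^sub>k)| p(e i\<^sub>k)\<close> factorises into \<open>n\<close> sums over one index, and
  each is at most \<open>q(x\<^sub>k)\<close>.  The infimum over the representations of a tensor by pure tensors gives
  \<open>q\<^sup>n\<close>.  The symmetrizer costs nothing: it fixes the symmetric tensor \<open>v\<close> by idempotence, and
  the basis vectors are homogeneous, so that symmetrizing their product only averages signed
  rearrangements (\<open>tensor_seminorm_symmetrizer\<close>).

  A linearly independent family of monomials \<open>e u\<close>, \<open>u \<in> J\<close>, contains at most one word from each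
  orbit under rearrangement, because rearranged monomials agree up to a sign.  The value of \<open>\<phi> u\<close> at
  a nonzero monomial \<open>e u\<close> is the inverse of the size of the orbit of \<open>u\<close>, and \<open>|\<phi> w (v)|\<close> is constant
  for \<open>w\<close> in the orbit.  So the term of \<open>u\<close> for the normalised functional is the sum of \<open>a\<close> over
  the orbit, and the estimate for \<open>J\<close> follows from the one for all words
  (\<open>normalised_functional_norm\<close>, \<open>absolute_estimate_monomials\<close>).

  The estimate makes the partial sum operators of the expansion equicontinuous, and biorthogonality
  makes them eventually constant on the span of the monomials.  This span is dense
  (\<open>monomials_dense\<close>): homogeneous factors of a tensor can be approximated by homogeneous
  combinations of basis vectors, since the projections to the even and odd part are continuous.
  Hence the expansion converges everywhere (\<open>absolute_schauder_basis_if_dense\<close>).  The argument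
  uses a single exponent at a time, so it applies to the topology of the symmetric algebra and
  to that of the Weyl algebra alike.
\<close>

section \<open>Koszul signs\<close>

lemma koszul_sign_as_product:
  "koszul_sign V1 \<sigma> vs =
    (\<Prod>(i, j)\<in>{(i, j). i < j \<and> j < length vs}.
       if \<sigma> i > \<sigma> j \<and> vs ! \<sigma> i \<in> V1 \<and> vs ! \<sigma> j \<in> V1 then -1 else (1::'k::field))"
proof -
  let ?Q = "{(i, j). i < j \<and> j < length vs}"
  let ?P = "\<lambda>(i, j). \<sigma> i > \<sigma> j \<and> vs ! \<sigma> i \<in> V1 \<and> vs ! \<sigma> j \<in> V1"
  have fin: "finite ?Q"
    by (rule finite_subset[of _ "{..<length vs} \<times> {..<length vs}"]) auto
  have "(\<Prod>x\<in>?Q. if ?P x then -1 else (1::'k)) = (\<Prod>x\<in>?Q \<inter> {x. ?P x}. -1)"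
    by (simp add: prod.If_cases[OF fin] Int_def)
  also have "\<dots> = (-1) ^ card (?Q \<inter> {x. ?P x})" by simp
  also have "?Q \<inter> {x. ?P x} =
    {(i, j). i < j \<and> j < length vs \<and> \<sigma> i > \<sigma> j \<and> vs ! \<sigma> i \<in> V1 \<and> vs ! \<sigma> j \<in> V1}" by auto
  finally show ?thesis unfolding koszul_sign_def by (simp add: case_prod_unfold)
qed

text \<open>
  The composite reverses the pair \<open>{i, j}\<close> exactly if either \<open>\<sigma>\<close> reverses \<open>{i, j}\<close> or \<open>\<tau>\<close> reverses
  \<open>{\<sigma> i, \<sigma> j}\<close>, but not both, and \<open>\<sigma>\<close> permutes the unordered pairs.  Parities belong to the vectors,
  not to the positions, so that both factors see the same odd pairs.
\<close>

lemma koszul_sign_compose: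
  assumes \<sigma>: "\<sigma> permutes {..<length vs}" and \<tau>: "\<tau> permutes {..<length vs}"
  shows "koszul_sign V1 (\<tau> \<circ> \<sigma>) vs =
    koszul_sign V1 \<tau> vs * (koszul_sign V1 \<sigma> (permute_list \<tau> vs) :: 'k::field)"
proof -
  let ?n = "length vs"
  let ?Q = "{(i, j). i < j \<and> j < ?n}"
  define s :: "(nat \<Rightarrow> nat) \<Rightarrow> (nat \<Rightarrow> bool) \<Rightarrow> nat \<times> nat \<Rightarrow> 'k" where
    "s \<rho> D x = (case x of (i, j) \<Rightarrow> if \<rho> i > \<rho> j \<and> D (\<rho> i) \<and> D (\<rho> j) then -1 else 1)" for \<rho> D x
  \<comment> \<open>the action of \<open>\<sigma>\<close> on unordered pairs, each written in increasing order\<close>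
  define g where "g x = (case x of (i, j) \<Rightarrow> if \<sigma> i < \<sigma> j then (\<sigma> i, \<sigma> j) else (\<sigma> j, \<sigma> i))" for x
  let ?D = "\<lambda>k. vs ! k \<in> V1"
  have \<sigma>n: "\<sigma> i < ?n" if "i < ?n" for i using permutes_in_image[OF \<sigma>, of i] that by auto
  have \<sigma>i: "\<sigma> i = \<sigma> j \<longleftrightarrow> i = j" for i j using permutes_inj[OF \<sigma>] by (metis injD)
  have \<tau>i: "\<tau> i = \<tau> j \<longleftrightarrow> i = j" for i j using permutes_inj[OF \<tau>] by (metis injD)
  have fin: "finite ?Q" by (rule finite_subset[of _ "{..<?n} \<times> {..<?n}"]) auto
  have "inj_on g ?Q"
    by (rule inj_onI) (auto simp: g_def \<sigma>i split: if_splits)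
  moreover have "g ` ?Q \<subseteq> ?Q"
  proof -
    have "g x \<in> ?Q" if x: "x \<in> ?Q" for x
    proof -
      obtain i j where "x = (i, j)" "i < j" "j < ?n" using x by (cases x) auto
      then show ?thesis using \<sigma>n[of i] \<sigma>n[of j] \<sigma>i[of i j] by (auto simp: g_def)
    qed
    then show ?thesis by (rule image_subsetI)
  qed
  ultimately have bij: "bij_betw g ?Q ?Q"
    using endo_inj_surj[OF fin] by (simp add: bij_betw_def)
  have "koszul_sign V1 (\<tau> \<circ> \<sigma>) vs = (\<Prod>x\<in>?Q. s (\<tau> \<circ> \<sigma>) ?D x)"
    by (simp add: koszul_sign_as_product s_def)
  also have "\<dots> = (\<Prod>x\<in>?Q. s \<tau> ?D (g x) * s \<sigma> (\<lambda>k. ?D (\<tau> k)) x)"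
  proof (rule prod.cong[OF refl])
    fix x assume "x \<in> ?Q"
    then obtain i j where x: "x = (i, j)" "i < j" by (cases x) auto
    then have "\<sigma> i \<noteq> \<sigma> j" "\<tau> (\<sigma> i) \<noteq> \<tau> (\<sigma> j)" by (auto simp: \<sigma>i \<tau>i)
    then show "s (\<tau> \<circ> \<sigma>) ?D x = s \<tau> ?D (g x) * s \<sigma> (\<lambda>k. ?D (\<tau> k)) x"
      unfolding x by (auto simp: s_def g_def)
  qed
  also have "\<dots> = (\<Prod>x\<in>?Q. s \<tau> ?D x) * (\<Prod>x\<in>?Q. s \<sigma> (\<lambda>k. ?D (\<tau> k)) x)"
    using prod.reindex_bij_betw[OF bij, of "s \<tau> ?D"] by (simp add: prod.distrib)
  also have "(\<Prod>x\<in>?Q. s \<tau> ?D x) = koszul_sign V1 \<tau> vs"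
    by (simp add: koszul_sign_as_product s_def)
  also have "(\<Prod>x\<in>?Q. s \<sigma> (\<lambda>k. ?D (\<tau> k)) x) = koszul_sign V1 \<sigma> (permute_list \<tau> vs)"
    unfolding koszul_sign_as_product s_def
    using \<sigma>n by (intro prod.cong) (auto simp: permute_list_nth[OF \<tau>])
  finally show ?thesis .
qed

lemma koszul_sign_cases: "koszul_sign V1 \<sigma> vs = (1::'k::field) \<or> koszul_sign V1 \<sigma> vs = (-1::'k)"
  by (auto simp: koszul_sign_def minus_one_power_iff)

lemma koszul_sign_square: "koszul_sign V1 \<sigma> vs * koszul_sign V1 \<sigma> vs = (1::'k::field)"
  using koszul_sign_cases[of V1 \<sigma> vs, where 'k='k] by auto

section \<open>The symmetrizer\<close>

interpretation tensor: vector_space "tscale :: 'k::field \<Rightarrow> ('k, 'v) tensor \<Rightarrow> ('k, 'v) tensor"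
  by (rule vector_space_tscale)

interpretation tensors: vector_space "sscale :: 'k::field \<Rightarrow> ('k, 'v) tensors \<Rightarrow> ('k, 'v) tensors"
  by unfold_locales (auto simp: sscale_def fun_eq_iff tensor.scale_right_distrib
      tensor.scale_left_distrib)

interpretation tensor_endo: vector_space_pair
  "tscale :: 'k::field \<Rightarrow> ('k, 'v) tensor \<Rightarrow> ('k, 'v) tensor"
  "tscale :: 'k::field \<Rightarrow> ('k, 'v) tensor \<Rightarrow> ('k, 'v) tensor" ..

context graded_locally_convex_space
begin

abbreviation "\<S> \<equiv> symmetrizer smul V0 V1"

abbreviation "homogeneous vs \<equiv> set vs \<subseteq> V0 \<union> V1"

lemma linear_tens_update:
  "i < length vs \<Longrightarrow> Vector_Spaces.linear smul tscale (\<lambda>x. tens smul (vs[i := x]))"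
  using multilinear_tens[OF vector_space_axioms, of "length vs"] by (auto simp: multilinear_def)

lemma tens_update_add:
  "i < length vs \<Longrightarrow> tens smul (vs[i := x + y]) = tens smul (vs[i := x]) + tens smul (vs[i := y])"
  using module_hom.add[OF Vector_Spaces.linear.axioms(3)[OF linear_tens_update]] .

lemma tens_update_scale:
  "i < length vs \<Longrightarrow> tens smul (vs[i := smul c x]) = tscale c (tens smul (vs[i := x]))"
  using module_hom.scale[OF Vector_Spaces.linear.axioms(3)[OF linear_tens_update]] .

lemma tens_update_diff:
  "i < length vs \<Longrightarrow> tens smul (vs[i := x - y]) = tens smul (vs[i := x]) - tens smul (vs[i := y])"
  using module_hom.diff[OF Vector_Spaces.linear.axioms(3)[OF linear_tens_update]] .

lemma tens_update_zero: "i < length vs \<Longrightarrow> tens smul (vs[i := 0]) = 0"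
  using module_hom.zero[OF Vector_Spaces.linear.axioms(3)[OF linear_tens_update]] .

lemma tens_in_tensor_power: "tens smul vs \<in> tensor_power smul (length vs)"
  unfolding tensor_power_def by (rule tensor.span_base) auto

lemma subspace_tensor_power: "tensor.subspace (tensor_power smul n)"
  unfolding tensor_power_def by (rule tensor.subspace_span)

text \<open>
  Multilinearity, one entry at a time.  The lemma serves twice: with the homogeneous vectors, which
  span everything, and with the basis vectors, whose span is only dense.
\<close>

lemma tens_in_span:
  assumes "set vs \<subseteq> span B"
  shows "tens smul vs \<in> tensor.span {tens smul ws | ws. length ws = length vs \<and> set ws \<subseteq> B}"
    (is "_ \<in> tensor.span ?H")
proof -
  have "tens smul ws \<in> tensor.span ?H"
    if "k \<le> length vs" "length ws = length vs" "set ws \<subseteq> span B"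
      "\<And>i. k \<le> i \<Longrightarrow> i < length vs \<Longrightarrow> ws ! i \<in> B" for ws k
    using that
  proof (induction k arbitrary: ws)
    case 0
    then have "set ws \<subseteq> B" by (auto simp: set_conv_nth)
    with 0 show ?case by (auto intro: tensor.span_base)
  next
    case (Suc k)
    have base: "tens smul (ws[k := b]) \<in> tensor.span ?H" if "b \<in> B" for b
      using Suc.prems that set_update_subset_insert[of ws k b] span_base[of b B]
      by (intro Suc.IH) (auto simp: nth_list_update)
    have "tens smul (ws[k := x]) \<in> tensor.span ?H" if "x \<in> span B" for x
      using that
    proof (induction rule: span_induct_alt)
      case base
      show ?case using Suc.prems by (simp only: tens_update_zero tensor.span_zero)
    next
      case (step c x y)
      have "tens smul (ws[k := smul c x + y]) =
          tscale c (tens smul (ws[k := x])) + tens smul (ws[k := y])"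
        using Suc.prems by (simp only: tens_update_add tens_update_scale)
      then show ?case
        using step base by (simp only: tensor.span_add tensor.span_scale)
    qed
    moreover have "ws ! k \<in> span B"
      using Suc.prems(1,2) by (intro subsetD[OF Suc.prems(3)] nth_mem) simp
    ultimately have "tens smul (ws[k := ws ! k]) \<in> tensor.span ?H" .
    then show ?case by simp
  qed
  from this[of "length vs" vs] assms show ?thesis by simp
qed

lemma tensor_power_homogeneous:
  "tensor_power smul n = tensor.span {tens smul vs | vs. length vs = n \<and> homogeneous vs}"
    (is "_ = tensor.span ?H")
proof
  have "x \<in> span (V0 \<union> V1)" for x
  proof -
    obtain a b where "a \<in> V0" "b \<in> V1" "x = a + b" using decompose by metis
    then show ?thesis by (auto intro: span_add span_base)
  qed
  then have "{tens smul vs | vs. length vs = n} \<subseteq> tensor.span ?H"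
    using tens_in_span[of _ "V0 \<union> V1"] by fastforce
  then show "tensor_power smul n \<subseteq> tensor.span ?H"
    unfolding tensor_power_def by (rule tensor.span_minimal) (rule tensor.subspace_span)
  show "tensor.span ?H \<subseteq> tensor_power smul n"
    unfolding tensor_power_def by (rule tensor.span_mono) auto
qed

lemma linear_symmetrizer: "Vector_Spaces.linear tscale tscale (\<S> n)"
proof -
  have "Vector_Spaces.linear tscale tscale
      (\<lambda>X. tscale (1 / fact n) (\<Sum>\<sigma> | \<sigma> permutes {..<n}. tensor_act smul V0 V1 n \<sigma> X))"
    using is_tensor_act_tensor_act
    by (intro tensor_endo.linear_compose_scale_right tensor_endo.linear_compose_sum)
       (auto simp: is_tensor_act_def)
  then show ?thesis by (simp add: symmetrizer_def[abs_def])
qed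

lemmas symmetrizer_add = module_hom.add[OF Vector_Spaces.linear.axioms(3)[OF linear_symmetrizer]]
lemmas symmetrizer_diff = module_hom.diff[OF Vector_Spaces.linear.axioms(3)[OF linear_symmetrizer]]
lemmas symmetrizer_zero = module_hom.zero[OF Vector_Spaces.linear.axioms(3)[OF linear_symmetrizer]]
lemmas symmetrizer_scale = module_hom.scale[OF Vector_Spaces.linear.axioms(3)[OF linear_symmetrizer]]
lemmas symmetrizer_sum = module_hom.sum[OF Vector_Spaces.linear.axioms(3)[OF linear_symmetrizer]]

lemma symmetrizer_tens:
  assumes "homogeneous vs" "length vs = n"
  shows "\<S> n (tens smul vs) = tscale (1 / fact n)
    (\<Sum>\<sigma> | \<sigma> permutes {..<n}. tscale (koszul_sign V1 \<sigma> vs) (tens smul (permute_list \<sigma> vs)))"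
  using is_tensor_act_tensor_act assms
  by (auto simp: symmetrizer_def is_tensor_act_def intro!: arg_cong[where f = "tscale _"] sum.cong)

text \<open>
  By the composition rule for Koszul signs, permuting the factors only reindexes the sum over the
  symmetric group.  Idempotence of the symmetrizer and all sign relations between monomials follow.
\<close>

lemma symmetrizer_permute:
  assumes hom: "homogeneous vs" and len: "length vs = n" and \<tau>: "\<tau> permutes {..<n}"
  shows "\<S> n (tens smul (permute_list \<tau> vs)) =
    tscale (koszul_sign V1 \<tau> vs) (\<S> n (tens smul vs))"
proof -
  let ?k = "koszul_sign V1 \<tau> vs :: 'k"
  let ?f = "\<lambda>\<sigma>. tscale (koszul_sign V1 \<sigma> vs) (tens smul (permute_list \<sigma> vs))"
  have "tscale (koszul_sign V1 \<sigma> (permute_list \<tau> vs)) (tens smul (permute_list \<sigma> (permute_list \<tau> vs)))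
      = tscale ?k (?f (\<tau> \<circ> \<sigma>))" if "\<sigma> permutes {..<n}" for \<sigma>
  proof -
    have "koszul_sign V1 \<sigma> (permute_list \<tau> vs) = ?k * koszul_sign V1 (\<tau> \<circ> \<sigma>) vs"
      using that \<tau> len
      by (simp add: koszul_sign_compose koszul_sign_square mult.assoc[symmetric])
    then show ?thesis using that len by (simp add: permute_list_compose)
  qed
  then have "\<S> n (tens smul (permute_list \<tau> vs)) =
      tscale (1 / fact n) (\<Sum>\<sigma> | \<sigma> permutes {..<n}. tscale ?k (?f (\<tau> \<circ> \<sigma>)))"
    using hom len \<tau> by (subst symmetrizer_tens) (auto intro!: arg_cong[where f = "tscale _"] sum.cong)
  also have "(\<Sum>\<sigma> | \<sigma> permutes {..<n}. tscale ?k (?f (\<tau> \<circ> \<sigma>))) =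
      (\<Sum>\<sigma> | \<sigma> permutes {..<n}. tscale ?k (?f \<sigma>))"
    by (rule setum_permutations_compose_left[OF \<tau>, symmetric])
  also have "tscale (1 / fact n) \<dots> = tscale ?k (\<S> n (tens smul vs))"
    unfolding symmetrizer_tens[OF hom len] tensor.scale_sum_right[symmetric]
    by (rule tensor.scale_left_commute)
  finally show ?thesis .
qed

lemma symmetrizer_idem_tens:
  assumes hom: "homogeneous vs" and len: "length vs = n"
  shows "\<S> n (\<S> n (tens smul vs)) = \<S> n (tens smul vs)"
proof -
  have "\<S> n (\<S> n (tens smul vs)) = tscale (1 / fact n)
      (\<Sum>\<sigma> | \<sigma> permutes {..<n}. tscale (koszul_sign V1 \<sigma> vs) (\<S> n (tens smul (permute_list \<sigma> vs))))"
    using hom len by (simp add: symmetrizer_tens[of vs] symmetrizer_scale symmetrizer_sum)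
  also have "\<dots> = tscale (1 / fact n) (\<Sum>\<sigma> | \<sigma> permutes {..<n}. \<S> n (tens smul vs))"
    by (intro arg_cong[where f = "tscale _"] sum.cong)
       (auto simp: symmetrizer_permute[OF hom len] koszul_sign_square)
  also have "(\<Sum>\<sigma> | \<sigma> permutes {..<n}. \<S> n (tens smul vs)) = tscale (fact n) (\<S> n (tens smul vs))"
    by (simp only: tensor.sum_constant_scale card_permutations[OF refl] finite_lessThan card_lessThan of_nat_fact)
  finally show ?thesis by simp
qed

lemma symmetrizer_idem:
  assumes "X \<in> tensor_power smul n"
  shows "\<S> n (\<S> n X) = \<S> n X"
  using assms unfolding tensor_power_homogeneous
proof (induction rule: tensor.span_induct_alt)
  case base
  show ?case by (simp only: symmetrizer_zero)
next
  case (step c x y)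
  then obtain vs where vs: "x = tens smul vs" "length vs = n" "homogeneous vs" by auto
  show ?case
    by (simp only: symmetrizer_add symmetrizer_scale vs(1) symmetrizer_idem_tens[OF vs(3,2)] step)
qed

lemma symmetrizer_in_tensor_power:
  assumes "X \<in> tensor_power smul n"
  shows "\<S> n X \<in> tensor_power smul n"
  using assms unfolding tensor_power_homogeneous
proof (induction rule: tensor.span_induct_alt)
  case base
  show ?case by (simp only: symmetrizer_zero tensor.span_zero)
next
  case (step c x y)
  then obtain vs where vs: "x = tens smul vs" "length vs = n" "homogeneous vs" by auto
  have "\<S> n x \<in> tensor.span {tens smul vs | vs. length vs = n \<and> homogeneous vs}"
    unfolding vs(1) symmetrizer_tens[OF vs(3,2)]
    using vs
    by (intro tensor.span_scale tensor.span_sum tensor.span_base CollectI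
          exI[where x = "permute_list _ vs"]) auto
  with step show ?case
    by (simp only: symmetrizer_add symmetrizer_scale tensor.span_add tensor.span_scale)
qed

lemma sym_power_subset: "sym_power smul V0 V1 n \<subseteq> tensor_power smul n"
  by (auto simp: sym_power_def symmetrizer_in_tensor_power)

lemma symmetrizer_sym_power: "X \<in> sym_power smul V0 V1 n \<Longrightarrow> \<S> n X = X"
  by (auto simp: sym_power_def symmetrizer_idem)

lemma subspace_sym_power: "tensor.subspace (sym_power smul V0 V1 n)"
  unfolding sym_power_def
  by (rule tensor_endo.linear_subspace_image[OF linear_symmetrizer subspace_tensor_power])

lemma subspace_sym_algebra: "tensors.subspace (sym_algebra smul V0 V1)"
proof (rule tensors.subspaceI)
  show "0 \<in> sym_algebra smul V0 V1"
    using tensor.subspace_0[OF subspace_sym_power] by (auto simp: sym_algebra_def)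
next
  fix x y assume xy: "x \<in> sym_algebra smul V0 V1" "y \<in> sym_algebra smul V0 V1"
  have "{n. (x + y) n \<noteq> 0} \<subseteq> {n. x n \<noteq> 0} \<union> {n. y n \<noteq> 0}" by auto
  then have "finite {n. (x + y) n \<noteq> 0}"
    using xy finite_subset by (fastforce simp: sym_algebra_def)
  with xy show "x + y \<in> sym_algebra smul V0 V1"
    using tensor.subspace_add[OF subspace_sym_power] by (auto simp: sym_algebra_def)
next
  fix c x assume x: "x \<in> sym_algebra smul V0 V1"
  have "{n. sscale c x n \<noteq> 0} \<subseteq> {n. x n \<noteq> 0}" by (auto simp: sscale_def)
  then have "finite {n. sscale c x n \<noteq> 0}"
    using x finite_subset by (fastforce simp: sym_algebra_def)
  with x show "sscale c x \<in> sym_algebra smul V0 V1"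
    using tensor.subspace_scale[OF subspace_sym_power] by (auto simp: sym_algebra_def sscale_def)
qed

lemma symmetrizer_tens_in_sym_power: "length vs = n \<Longrightarrow> \<S> n (tens smul vs) \<in> sym_power smul V0 V1 n"
  using tens_in_tensor_power by (auto simp: sym_power_def)

lemma sym_monomial_in_sym_algebra: "sym_monomial smul V0 V1 e u \<in> sym_algebra smul V0 V1"
  using tensor.subspace_0[OF subspace_sym_power] symmetrizer_tens_in_sym_power[of "map e u"]
  by (auto simp: sym_algebra_def sym_monomial_def)

end

section \<open>Topologies given by directed families of seminorms\<close>

lemma continuous_seminorm_nonneg:
  assumes "vector_space smul" and p: "continuous_seminorm smul T p"
    and x: "x \<in> topspace T" "- x \<in> topspace T"
  shows "0 \<le> p x"
proof -
  interpret vector_space smul by fact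
  have "p (x + - x) \<le> p x + p (- x)" "p (smul 0 x) = 0" "p (smul (- 1) x) = p x"
    using p x unfolding continuous_seminorm_def by (blast, auto simp del: scale_zero_left scale_minus_left)
  then show ?thesis by simp
qed

locale directed_seminorms = vector_space smul
  for smul :: "'k::real_normed_field \<Rightarrow> 'w::ab_group_add \<Rightarrow> 'w" +
  fixes W :: "'w set" and P :: "('w \<Rightarrow> real) set"
  assumes carrier: "subspace W"
    and nonempty: "P \<noteq> {}"
    and triangle: "\<And>p x y. p \<in> P \<Longrightarrow> x \<in> W \<Longrightarrow> y \<in> W \<Longrightarrow> p (x + y) \<le> p x + p y"
    and scaling: "\<And>p c x. p \<in> P \<Longrightarrow> x \<in> W \<Longrightarrow> p (smul c x) = norm c * p x"
    and directed: "\<And>p q. p \<in> P \<Longrightarrow> q \<in> P \<Longrightarrow> \<exists>r\<in>P. \<forall>x\<in>W. p x \<le> r x \<and> q x \<le> r x"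
begin

abbreviation "topology_of_P \<equiv> seminorm_topology W P"

lemma seminorm_zero: "p \<in> P \<Longrightarrow> p 0 = 0"
  using scaling[of p 0 0] subspace_0[OF carrier] by simp

lemma seminorm_minus: "p \<in> P \<Longrightarrow> x \<in> W \<Longrightarrow> p (- x) = p x"
  using scaling[of p x "-1"] by simp

lemma seminorm_nonneg:
  assumes "p \<in> P" "x \<in> W"
  shows "0 \<le> p x"
  using triangle[of p x "- x"] seminorm_minus[of p x] seminorm_zero[of p] assms
    subspace_neg[OF carrier] by simp

lemma seminorm_commute: "p \<in> P \<Longrightarrow> x \<in> W \<Longrightarrow> y \<in> W \<Longrightarrow> p (x - y) = p (y - x)"
  using seminorm_minus[of p "x - y"] subspace_diff[OF carrier, of x y] by simp

lemma seminorm_diff_triangle: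
  assumes "p \<in> P" "x \<in> W" "y \<in> W" "z \<in> W"
  shows "p (x - z) \<le> p (x - y) + p (y - z)"
  using triangle[of p "x - y" "y - z"] assms subspace_diff[OF carrier] by simp

lemma seminorm_sum:
  assumes "p \<in> P" "\<And>i. i \<in> A \<Longrightarrow> f i \<in> W"
  shows "p (\<Sum>i\<in>A. f i) \<le> (\<Sum>i\<in>A. p (f i))"
  using assms(2)
proof (induction A rule: infinite_finite_induct)
  case (insert a A)
  have "p (f a + (\<Sum>i\<in>A. f i)) \<le> p (f a) + p (\<Sum>i\<in>A. f i)"
    using insert.prems by (intro triangle[OF assms(1)] subspace_sum[OF carrier]) auto
  with insert show ?case by fastforce
qed (simp_all add: seminorm_zero[OF assms(1)])

lemma topspace_eq: "topspace topology_of_P = W"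
  unfolding seminorm_topology_def topology_generated_by_topspace by auto

lemma openin_ball:
  assumes "p \<in> P" "x \<in> W" "0 < r"
  shows "openin topology_of_P {y\<in>W. p (y - x) < r}"
  unfolding seminorm_topology_def by (rule topology_generated_by_Basis) (use assms in blast)

text \<open>Directedness makes single balls, rather than finite intersections, a neighbourhood base.\<close>

lemma openin_contains_ball:
  assumes "openin topology_of_P U" "x \<in> U"
  shows "\<exists>p\<in>P. \<exists>r>0. {y\<in>W. p (y - x) < r} \<subseteq> U"
proof -
  have "generate_topology_on (insert W {{y\<in>W. p (y - x) < r} | p x r. p \<in> P \<and> x \<in> W \<and> 0 < r}) U"
    using assms(1) by (simp add: seminorm_topology_def openin_topology_generated_by_iff)
  then show ?thesis
    using assms(2)
  proof (induction arbitrary: x rule: generate_topology_on.induct)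
    case Empty
    then show ?case by simp
  next
    case (Int A B)
    then have x: "x \<in> A" "x \<in> B" by auto
    obtain p r where p: "p \<in> P" "0 < r" "{y\<in>W. p (y - x) < r} \<subseteq> A"
      using Int.IH(1)[OF x(1)] by blast
    obtain q s where q: "q \<in> P" "0 < s" "{y\<in>W. q (y - x) < s} \<subseteq> B"
      using Int.IH(2)[OF x(2)] by blast
    have AW: "A \<subseteq> W"
    proof -
      have "openin topology_of_P A"
        using Int.hyps by (simp add: seminorm_topology_def openin_topology_generated_by_iff)
      then show ?thesis using openin_subset topspace_eq by blast
    qed
    obtain t where t: "t \<in> P" "\<And>y. y \<in> W \<Longrightarrow> p y \<le> t y \<and> q y \<le> t y"
      using directed[OF p(1) q(1)] by blast
    have "{y\<in>W. t (y - x) < min r s} \<subseteq> A \<inter> B"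
    proof
      fix y assume y: "y \<in> {y\<in>W. t (y - x) < min r s}"
      then have "p (y - x) \<le> t (y - x) \<and> q (y - x) \<le> t (y - x)"
        using AW x(1) by (intro t(2) subspace_diff[OF carrier]) auto
      with y have "p (y - x) < r" "q (y - x) < s" "y \<in> W" by auto
      then show "y \<in> A \<inter> B" using p(3) q(3) by blast
    qed
    with t(1) p(2) q(2) show ?case by (intro bexI[of _ t] exI[of _ "min r s"]) auto
  next
    case (UN K)
    then obtain k where "k \<in> K" "x \<in> k" by blast
    with UN.IH[of k x] obtain p r where "p \<in> P" "0 < r" "{y\<in>W. p (y - x) < r} \<subseteq> k" by blast
    with \<open>k \<in> K\<close> show ?case by blast
  next
    case (Basis s)
    show ?case
    proof (cases "s = W")
      case True
      obtain p where "p \<in> P" using nonempty by blast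
      with True show ?thesis by (intro bexI[of _ p] exI[of _ 1]) auto
    next
      case False
      then obtain p z r where s: "s = {y\<in>W. p (y - z) < r}" "p \<in> P" "z \<in> W" "0 < r"
        using Basis by blast
      have x: "x \<in> W" "p (x - z) < r" using Basis s by auto
      have "{y\<in>W. p (y - x) < r - p (x - z)} \<subseteq> s"
      proof
        fix y assume y: "y \<in> {y\<in>W. p (y - x) < r - p (x - z)}"
        then show "y \<in> s" using seminorm_diff_triangle[of p y x z] s x by auto
      qed
      with s(2) x(2) show ?thesis by (intro bexI[of _ p] exI[of _ "r - p (x - z)"]) auto
    qed
  qed
qed

lemma continuous_map_if_lipschitz:
  fixes f :: "'w \<Rightarrow> 'a::metric_space"
  assumes p: "p \<in> P" and f: "\<And>x y. x \<in> W \<Longrightarrow> y \<in> W \<Longrightarrow> dist (f x) (f y) \<le> C * p (x - y)"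
  shows "continuous_map topology_of_P euclidean f"
  unfolding continuous_map_def
proof (intro conjI allI impI)
  fix U :: "'a set" assume "openin euclidean U"
  then have U: "open U" by simp
  show "openin topology_of_P {x \<in> topspace topology_of_P. f x \<in> U}"
  proof (subst openin_subopen, intro ballI)
    fix x assume x: "x \<in> {x \<in> topspace topology_of_P. f x \<in> U}"
    then have xW: "x \<in> W" by (simp add: topspace_eq)
    obtain \<epsilon> where \<epsilon>: "0 < \<epsilon>" "\<And>z. dist z (f x) < \<epsilon> \<Longrightarrow> z \<in> U"
      using U x by (auto simp: open_dist)
    let ?r = "\<epsilon> / (\<bar>C\<bar> + 1)"
    have r: "0 < ?r" using \<epsilon>(1) by simp
    have "f y \<in> U" if y: "y \<in> W" "p (y - x) < ?r" for y
    proof (rule \<epsilon>(2))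
      have nn: "0 \<le> p (y - x)" using y xW by (intro seminorm_nonneg[OF p] subspace_diff[OF carrier])
      have "dist (f y) (f x) \<le> C * p (y - x)" by (rule f[OF y(1) xW])
      also have "\<dots> \<le> (\<bar>C\<bar> + 1) * p (y - x)" by (intro mult_right_mono nn) auto
      also have "\<dots> < \<epsilon>" using y(2) by (simp add: pos_less_divide_eq mult.commute)
      finally show "dist (f y) (f x) < \<epsilon>" .
    qed
    then show "\<exists>V. openin topology_of_P V \<and> x \<in> V \<and> V \<subseteq> {x \<in> topspace topology_of_P. f x \<in> U}"
      using openin_ball[OF p xW r] xW r seminorm_zero[OF p]
      by (intro exI[of _ "{y\<in>W. p (y - x) < ?r}"]) (auto simp: topspace_eq)
  qed
qed simp

lemma continuous_seminorm_multiple: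
  assumes p: "p \<in> P" and C: "0 \<le> C"
  shows "continuous_seminorm smul topology_of_P (\<lambda>x. C * p x)"
  unfolding continuous_seminorm_def topspace_eq
proof (intro conjI ballI allI)
  show "C * p (x + y) \<le> C * p x + C * p y" if "x \<in> W" "y \<in> W" for x y
    using mult_left_mono[OF triangle[OF p that] C] by (simp add: distrib_left)
  show "C * p (smul c x) = norm c * (C * p x)" if "x \<in> W" for c x
    using that by (simp add: scaling[OF p])
  show "continuous_map topology_of_P euclidean (\<lambda>x. C * p x)"
  proof (rule continuous_map_if_lipschitz[OF p])
    fix x y assume xy: "x \<in> W" "y \<in> W"
    have "\<bar>p x - p y\<bar> \<le> p (x - y)"
      using triangle[OF p subspace_diff[OF carrier xy] xy(2)]
        triangle[OF p subspace_diff[OF carrier xy(2,1)] xy(1)] seminorm_commute[OF p xy] by simp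
    then have "\<bar>C\<bar> * \<bar>p x - p y\<bar> \<le> C * p (x - y)" using C by (simp add: mult_left_mono)
    then show "dist (C * p x) (C * p y) \<le> C * p (x - y)"
      by (simp add: dist_real_def abs_mult[symmetric] right_diff_distrib)
  qed
qed

lemma continuous_seminorm_dominated:
  assumes Q: "continuous_seminorm smul topology_of_P Q"
  shows "\<exists>p\<in>P. \<exists>C>0. \<forall>x\<in>W. Q x \<le> C * p x"
proof -
  have Qs: "Q (smul c x) = norm c * Q x" if "x \<in> W" for c x
    using Q that by (simp add: continuous_seminorm_def topspace_eq)
  have zero: "0 \<in> W" by (rule subspace_0[OF carrier])
  have "openin topology_of_P {x \<in> topspace topology_of_P. Q x \<in> {..<1}}"
    using Q by (intro openin_continuous_map_preimage[of _ euclidean])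
      (auto simp: continuous_seminorm_def)
  moreover have "0 \<in> {x \<in> topspace topology_of_P. Q x \<in> {..<1}}"
    using zero Qs[OF zero, of 0] by (simp add: topspace_eq)
  ultimately have "\<exists>p\<in>P. \<exists>r>0. {y\<in>W. p (y - 0) < r} \<subseteq> {x \<in> topspace topology_of_P. Q x \<in> {..<1}}"
    by (rule openin_contains_ball)
  then obtain p r where p: "p \<in> P" "0 < r"
    and sub: "{y\<in>W. p (y - 0) < r} \<subseteq> {x \<in> topspace topology_of_P. Q x \<in> {..<1}}"
    by blast
  \<comment> \<open>Otherwise scaling \<open>x\<close> to \<open>Q x = 1\<close> puts it into the ball, on which \<open>Q < 1\<close>.  The factor \<open>2\<close>
    makes this work also if \<open>p x = 0\<close>.\<close>
  have "Q x \<le> (2 / r) * p x" if x: "x \<in> W" for x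
  proof (rule ccontr)
    assume contra: "\<not> Q x \<le> (2 / r) * p x"
    have nn: "0 \<le> p x" by (rule seminorm_nonneg[OF p(1) x])
    then have "0 \<le> (2 / r) * p x" using p(2) by simp
    then have Qx: "0 < Q x" using contra by linarith
    define c :: 'k where "c = of_real (1 / Q x)"
    have c: "norm c = 1 / Q x" using Qx unfolding c_def norm_of_real by simp
    have "2 * p x < r * Q x" using contra p(2) by (simp add: field_simps)
    then have "p x < r * Q x" using nn by linarith
    then have "p (smul c x) < r" using Qx by (simp add: scaling[OF p(1) x] c field_simps)
    then have "Q (smul c x) < 1" using sub subspace_scale[OF carrier x] by auto
    then show False using Qx by (simp add: Qs[OF x] c)
  qed
  then show ?thesis using p by (intro bexI[of _ p] exI[of _ "2 / r"]) auto
qed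

lemma continuous_functional_if_bounded:
  assumes "\<And>x y. x \<in> W \<Longrightarrow> y \<in> W \<Longrightarrow> f (x + y) = f x + f y"
    and scale: "\<And>c x. x \<in> W \<Longrightarrow> f (smul c x) = c * f x"
    and p: "p \<in> P" and bound: "\<And>x. x \<in> W \<Longrightarrow> norm (f x) \<le> C * p x"
  shows "continuous_functional smul topology_of_P f"
  unfolding continuous_functional_def topspace_eq
proof (intro conjI ballI allI)
  show "continuous_map topology_of_P euclidean f"
  proof (rule continuous_map_if_lipschitz[OF p])
    fix x y assume xy: "x \<in> W" "y \<in> W"
    have "f x = f (x - y) + f y"
      using assms(1)[of "x - y" y] xy subspace_diff[OF carrier] by simp
    then have "dist (f x) (f y) = norm (f (x - y))" by (simp add: dist_norm)
    also have "\<dots> \<le> C * p (x - y)" using xy by (intro bound subspace_diff[OF carrier])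
    finally show "dist (f x) (f y) \<le> C * p (x - y)" .
  qed
qed (use assms in auto)

text \<open>
  By the estimate the partial sum operators are equicontinuous; by biorthogonality each of them
  fixes the vectors in the span of the basis vectors that it uses.  Hence they converge to the
  identity pointwise as soon as that span is dense.
\<close>

lemma absolute_schauder_basis_if_dense:
  fixes e :: "'i \<Rightarrow> 'w" and \<psi> :: "'i \<Rightarrow> 'w \<Rightarrow> 'k"
  assumes e: "e ` J \<subseteq> W" "inj_on e J" "independent (e ` J)"
    and add: "\<And>u x y. u \<in> J \<Longrightarrow> x \<in> W \<Longrightarrow> y \<in> W \<Longrightarrow> \<psi> u (x + y) = \<psi> u x + \<psi> u y"
    and scale: "\<And>u c x. u \<in> J \<Longrightarrow> x \<in> W \<Longrightarrow> \<psi> u (smul c x) = c * \<psi> u x"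
    and bounded: "\<And>u. u \<in> J \<Longrightarrow> \<exists>p\<in>P. \<exists>C. \<forall>x\<in>W. norm (\<psi> u x) \<le> C * p x"
    and biorthogonal: "\<And>u w. u \<in> J \<Longrightarrow> w \<in> J \<Longrightarrow> \<psi> u (e w) = (if u = w then 1 else 0)"
    and dense: "\<And>p v \<epsilon>. p \<in> P \<Longrightarrow> v \<in> W \<Longrightarrow> 0 < \<epsilon> \<Longrightarrow> \<exists>w\<in>span (e ` J). p (v - w) < \<epsilon>"
    and estimate: "\<And>p. p \<in> P \<Longrightarrow> \<exists>q\<in>P. absolute_estimate W J e \<psi> p q"
  shows "absolute_schauder_basis smul topology_of_P J e \<psi>"
proof -
  define S where "S F v = (\<Sum>u\<in>F. smul (\<psi> u v) (e u))" for F v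
  have eW: "e u \<in> W" if "u \<in> J" for u using e(1) that by blast
  have spanW: "span (e ` J) \<subseteq> W" using e(1) carrier by (rule span_minimal)
  have SW: "S F v \<in> W" if "F \<subseteq> J" for F v
    unfolding S_def using that eW by (intro subspace_sum[OF carrier] subspace_scale[OF carrier]) auto
  have S_add: "S F (x + y) = S F x + S F y" if "F \<subseteq> J" "x \<in> W" "y \<in> W" for F x y
    unfolding S_def sum.distrib[symmetric]
  proof (rule sum.cong[OF refl])
    fix u assume "u \<in> F"
    then show "smul (\<psi> u (x + y)) (e u) = smul (\<psi> u x) (e u) + smul (\<psi> u y) (e u)"
      using that add[of u x y] by (auto simp: scale_left_distrib)
  qed
  have S_scale: "S F (smul c x) = smul c (S F x)" if "F \<subseteq> J" "x \<in> W" for F c x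
    unfolding S_def scale_sum_right
  proof (rule sum.cong[OF refl])
    fix u assume "u \<in> F"
    then show "smul (\<psi> u (smul c x)) (e u) = smul c (smul (\<psi> u x) (e u))"
      using that scale[of u x c] by auto
  qed
  have S_fix: "\<exists>F0. finite F0 \<and> F0 \<subseteq> J \<and> (\<forall>F. finite F \<and> F0 \<subseteq> F \<and> F \<subseteq> J \<longrightarrow> S F w = w)"
    if "w \<in> span (e ` J)" for w
    using that
  proof (induction rule: span_induct_alt)
    case base
    have "S F 0 = 0" if "F \<subseteq> J" for F
      using S_scale[OF that subspace_0[OF carrier], of 0] by simp
    then show ?case by auto
  next
    case (step c x y)
    then obtain u where u: "u \<in> J" "x = e u" by auto
    obtain F0 where "finite F0 \<and> F0 \<subseteq> J \<and> (\<forall>F. finite F \<and> F0 \<subseteq> F \<and> F \<subseteq> J \<longrightarrow> S F y = y)"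
      using step(2) by (rule exE)
    then have F0: "finite F0" "F0 \<subseteq> J"
      "\<And>F. finite F \<Longrightarrow> F0 \<subseteq> F \<Longrightarrow> F \<subseteq> J \<Longrightarrow> S F y = y" by simp_all
    have yW: "y \<in> W" using SW[OF F0(2), of y] F0(3)[OF F0(1) subset_refl F0(2)] by simp
    have "S F (smul c x + y) = smul c x + y" if F: "finite F" "insert u F0 \<subseteq> F" "F \<subseteq> J" for F
    proof -
      have "S F (e u) = (\<Sum>w\<in>F. if w = u then e u else 0)"
        unfolding S_def
      proof (rule sum.cong[OF refl])
        fix w assume "w \<in> F"
        then show "smul (\<psi> w (e u)) (e w) = (if w = u then e u else 0)"
          using biorthogonal[of w u] u F(3) by auto
      qed
      also have "\<dots> = e u" using F by simp
      finally have "S F (e u) = e u" .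
      moreover have "S F y = y" using F F0(3) by auto
      ultimately show ?thesis
        using S_add[OF F(3) subspace_scale[OF carrier eW[OF u(1)]] yW] S_scale[OF F(3) eW[OF u(1)]] u
        by simp
    qed
    then show ?case using F0(1,2) u by (intro exI[of _ "insert u F0"]) auto
  qed
  have S_bound: "p (S F v) \<le> q v"
    if p: "p \<in> P" and q: "absolute_estimate W J e \<psi> p q" and F: "finite F" "F \<subseteq> J" and v: "v \<in> W"
    for p q F v
  proof -
    have "p (S F v) \<le> (\<Sum>u\<in>F. p (smul (\<psi> u v) (e u)))"
      unfolding S_def using F eW by (intro seminorm_sum[OF p] subspace_scale[OF carrier]) auto
    also have "\<dots> = (\<Sum>u\<in>F. norm (\<psi> u v) * p (e u))"
      using F eW by (intro sum.cong scaling[OF p]) auto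
    also have "\<dots> \<le> (\<Sum>\<^sub>\<infinity>u\<in>J. norm (\<psi> u v) * p (e u))"
      using q v F eW seminorm_nonneg[OF p]
      by (intro finite_sum_le_infsum) (auto simp: absolute_estimate_def)
    also have "\<dots> \<le> q v" using q v by (auto simp: absolute_estimate_def)
    finally show ?thesis .
  qed
  have "limitin topology_of_P (\<lambda>F. \<Sum>u\<in>F. smul (\<psi> u v) (e u)) v (finite_subsets_at_top J)"
    if v: "v \<in> W" for v
    unfolding limitin_def topspace_eq S_def[symmetric]
  proof (intro conjI allI impI v)
    fix U assume "openin topology_of_P U \<and> v \<in> U"
    then obtain p r where p: "p \<in> P" and r: "0 < r" and sub: "{y\<in>W. p (y - v) < r} \<subseteq> U"
      using openin_contains_ball by blast
    obtain q where q: "q \<in> P" "absolute_estimate W J e \<psi> p q" using estimate[OF p] by blast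
    obtain t where t: "t \<in> P" "\<And>x. x \<in> W \<Longrightarrow> p x \<le> t x \<and> q x \<le> t x"
      using directed[OF p q(1)] by blast
    obtain w where w: "w \<in> span (e ` J)" "t (v - w) < r / 2" using dense[OF t(1) v, of "r / 2"] r by auto
    obtain F0 where "finite F0 \<and> F0 \<subseteq> J \<and> (\<forall>F. finite F \<and> F0 \<subseteq> F \<and> F \<subseteq> J \<longrightarrow> S F w = w)"
      using S_fix[OF w(1)] by (rule exE)
    then have F0: "finite F0" "F0 \<subseteq> J"
      "\<And>F. finite F \<Longrightarrow> F0 \<subseteq> F \<Longrightarrow> F \<subseteq> J \<Longrightarrow> S F w = w" by simp_all
    have wW: "w \<in> W" using w(1) spanW by blast
    have vw: "v - w \<in> W" by (rule subspace_diff[OF carrier v wW])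
    have "S F v \<in> U" if F: "finite F" "F0 \<subseteq> F" "F \<subseteq> J" for F
    proof -
      have "S F v = S F (v - w) + w"
        using S_add[OF F(3) vw wW] F0(3)[OF F] by simp
      then have "p (S F v - v) = p (S F (v - w) - (v - w))" by (simp add: algebra_simps)
      also have "\<dots> \<le> p (S F (v - w) - 0) + p (0 - (v - w))"
        by (rule seminorm_diff_triangle[OF p SW[OF F(3)] subspace_0[OF carrier] vw])
      also have "\<dots> \<le> q (v - w) + p (v - w)"
        using S_bound[OF p q(2) F(1,3) vw] seminorm_minus[OF p vw] by simp
      also have "\<dots> < r" using t(2)[OF vw] w(2) by linarith
      finally show ?thesis using sub SW[OF F(3)] by blast
    qed
    then show "\<forall>\<^sub>F F in finite_subsets_at_top J. S F v \<in> U"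
      unfolding eventually_finite_subsets_at_top using F0(1,2) by blast
  qed
  moreover have "\<exists>q. continuous_seminorm smul topology_of_P q \<and> absolute_estimate W J e \<psi> Q q"
    if Q: "continuous_seminorm smul topology_of_P Q" for Q
  proof -
    obtain p C where p: "p \<in> P" "0 < C" "\<And>x. x \<in> W \<Longrightarrow> Q x \<le> C * p x"
      using continuous_seminorm_dominated[OF Q] by blast
    obtain q where q: "q \<in> P" "absolute_estimate W J e \<psi> p q" using estimate[OF p(1)] by blast
    have Q0: "0 \<le> Q x" if "x \<in> W" for x
      using continuous_seminorm_nonneg[OF vector_space_axioms Q] that subspace_neg[OF carrier]
      by (simp add: topspace_eq)
    have "absolute_estimate W J e \<psi> Q (\<lambda>x. C * q x)"
      unfolding absolute_estimate_def
    proof (intro ballI conjI)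
      fix v assume v: "v \<in> W"
      have le: "norm (\<psi> u v) * Q (e u) \<le> C * (norm (\<psi> u v) * p (e u))" if "u \<in> J" for u
        using mult_left_mono[OF p(3)[OF eW[OF that]], of "norm (\<psi> u v)"] by (simp add: mult_ac)
      have sp: "(\<lambda>u. norm (\<psi> u v) * p (e u)) summable_on J"
        "(\<Sum>\<^sub>\<infinity>u\<in>J. norm (\<psi> u v) * p (e u)) \<le> q v"
        using q(2) v by (auto simp: absolute_estimate_def)
      have sC: "(\<lambda>u. C * (norm (\<psi> u v) * p (e u))) summable_on J"
        by (rule summable_on_cmult_right[OF sp(1)])
      show sQ: "(\<lambda>u. norm (\<psi> u v) * Q (e u)) summable_on J"
        by (rule summable_on_comparison_test[OF sC]) (use le Q0 eW in auto)
      have "(\<Sum>\<^sub>\<infinity>u\<in>J. norm (\<psi> u v) * Q (e u)) \<le> (\<Sum>\<^sub>\<infinity>u\<in>J. C * (norm (\<psi> u v) * p (e u)))"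
        by (rule infsum_mono[OF sQ sC le])
      also have "\<dots> = C * (\<Sum>\<^sub>\<infinity>u\<in>J. norm (\<psi> u v) * p (e u))" by (rule infsum_cmult_right')
      also have "\<dots> \<le> C * q v" using sp(2) p(2) by simp
      finally show "(\<Sum>\<^sub>\<infinity>u\<in>J. norm (\<psi> u v) * Q (e u)) \<le> C * q v" .
    qed
    then show ?thesis using continuous_seminorm_multiple[OF q(1), of C] p(2) by auto
  qed
  moreover have "continuous_functional smul topology_of_P (\<psi> u)" if u: "u \<in> J" for u
  proof -
    obtain p C where pC: "p \<in> P" "\<And>x. x \<in> W \<Longrightarrow> norm (\<psi> u x) \<le> C * p x"
      using bounded[OF u] by blast
    show ?thesis
      by (rule continuous_functional_if_bounded[OF _ _ pC]) (simp_all add: add[OF u] scale[OF u])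
  qed
  ultimately show ?thesis
    unfolding absolute_schauder_basis_def topspace_eq
    using e biorthogonal by auto
qed

end

section \<open>Projective tensor seminorms\<close>

lemma prod_list_nonneg:
  "(\<And>x. x \<in> set xs \<Longrightarrow> 0 \<le> x) \<Longrightarrow> 0 \<le> prod_list (xs :: real list)"
  by (induction xs) auto

lemma prod_list_mono:
  assumes "\<And>x. x \<in> set xs \<Longrightarrow> 0 \<le> f x \<and> f x \<le> (g x :: real)"
  shows "prod_list (map f xs) \<le> prod_list (map g xs)"
  using assms
proof (induction xs)
  case (Cons x xs)
  then have "0 \<le> f x" "f x \<le> g x" "0 \<le> prod_list (map f xs)"
    by (auto intro!: prod_list_nonneg)
  moreover have "prod_list (map f xs) \<le> prod_list (map g xs)" using Cons by auto
  ultimately show ?case by (simp add: mult_mono')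
qed simp

lemma prod_list_update:
  "i < length xs \<Longrightarrow> prod_list (xs[i := y]) = y * prod_list (xs[i := (1::'a::comm_monoid_mult)])"
proof (induction xs arbitrary: i)
  case (Cons x xs)
  then show ?case by (cases i) (auto simp: mult.left_commute)
qed simp

lemma fold_zero_fun: "(\<lambda>_. 0) = (0 :: 'a \<Rightarrow> 'b::zero)"
  by (rule ext) simp

text \<open>
  The projective seminorm of a tensor is the infimum of the costs of its representations as sums of
  pure tensors.  Upper bounds come from a single representation, lower bounds from an estimate of
  the cost of an arbitrary one.
\<close>

definition represents ::
  "('k::field \<Rightarrow> 'v::ab_group_add \<Rightarrow> 'v) \<Rightarrow> nat \<Rightarrow> ('k, 'v) tensor \<Rightarrow> ('k \<times> 'v list) list \<Rightarrow> bool" where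
  "represents smul n X xs \<longleftrightarrow>
     (\<forall>(c, vs)\<in>set xs. length vs = n) \<and> X = (\<Sum>(c, vs)\<leftarrow>xs. tscale c (tens smul vs))"

definition cost :: "('v \<Rightarrow> real) \<Rightarrow> ('k::real_normed_field \<times> 'v list) list \<Rightarrow> real" where
  "cost p xs = (\<Sum>(c, vs)\<leftarrow>xs. norm c * prod_list (map p vs))"

lemma tensor_seminorm_Inf:
  "tensor_seminorm smul n p X = Inf (cost p ` {xs. represents smul n X xs})"
  unfolding tensor_seminorm_def cost_def represents_def
  by (intro arg_cong[where f = Inf]) (auto simp: image_def)

lemma represents_append:
  "represents smul n X xs \<Longrightarrow> represents smul n Y ys \<Longrightarrow> represents smul n (X + Y) (xs @ ys)"
  by (auto simp: represents_def)

lemma tscale_sum_list: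
  "tscale a (\<Sum>x\<leftarrow>xs. f x) = (\<Sum>x\<leftarrow>xs. tscale a (f x))"
  by (induction xs)
     (simp_all only: list.map sum_list.Nil sum_list.Cons tensor.scale_zero_right
       tensor.scale_right_distrib)

lemma represents_scale:
  "represents smul n X xs \<Longrightarrow> represents smul n (tscale a X) (map (\<lambda>(c, vs). (a * c, vs)) xs)"
  by (auto simp: represents_def tscale_sum_list o_def case_prod_unfold)

lemma cost_append: "cost p (xs @ ys) = cost p xs + cost p ys"
  by (simp add: cost_def)

lemma cost_scale: "cost p (map (\<lambda>(c, vs). (a * c, vs)) xs) = norm a * cost p xs"
  by (induction xs) (auto simp: cost_def norm_mult algebra_simps)

lemma represents_exists:
  assumes "X \<in> tensor_power smul n"
  shows "\<exists>xs. represents smul n X xs"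
  using assms unfolding tensor_power_def
proof (induction rule: tensor.span_induct_alt)
  case base
  show ?case by (rule exI[of _ "[]"]) (simp add: represents_def fold_zero_fun)
next
  case (step c x y)
  then obtain xs vs where xs: "represents smul n y xs" and "x = tens smul vs" "length vs = n" by auto
  then have "represents smul n (tscale c x) [(c, vs)]" by (simp add: represents_def)
  from represents_append[OF this xs] show ?case by blast
qed

context graded_locally_convex_space
begin

abbreviation "seminorm \<equiv> continuous_seminorm smul T"

abbreviation "\<pi> n p \<equiv> tensor_seminorm smul n p"

lemma seminorm_nonneg: "seminorm p \<Longrightarrow> 0 \<le> p x"
  using continuous_seminorm_nonneg[OF vector_space_axioms] topspace_UNIV by fastforce

lemma seminorm_triangle: "seminorm p \<Longrightarrow> p (x + y) \<le> p x + p y"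
  by (auto simp: continuous_seminorm_def topspace_UNIV)

lemma seminorm_scale: "seminorm p \<Longrightarrow> p (smul c x) = norm c * p x"
  by (auto simp: continuous_seminorm_def topspace_UNIV)

lemma cost_nonneg: "seminorm p \<Longrightarrow> 0 \<le> cost p xs"
  unfolding cost_def
  by (intro sum_list_nonneg) (auto intro!: mult_nonneg_nonneg prod_list_nonneg simp: seminorm_nonneg)

lemma tensor_seminorm_le_cost:
  assumes "seminorm p" "represents smul n X xs"
  shows "\<pi> n p X \<le> cost p xs"
  unfolding tensor_seminorm_Inf
  using assms cost_nonneg[OF assms(1)] by (intro cInf_lower bdd_belowI[where m = 0]) auto

lemma le_tensor_seminorm:
  assumes "X \<in> tensor_power smul n" "\<And>xs. represents smul n X xs \<Longrightarrow> a \<le> cost p xs"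
  shows "a \<le> \<pi> n p X"
  unfolding tensor_seminorm_Inf
  using represents_exists[OF assms(1)] assms(2) by (intro cInf_greatest) auto

lemma tensor_seminorm_nonneg:
  "seminorm p \<Longrightarrow> X \<in> tensor_power smul n \<Longrightarrow> 0 \<le> \<pi> n p X"
  by (rule le_tensor_seminorm) (auto simp: cost_nonneg)

lemma tensor_seminorm_tens:
  assumes "seminorm p" "length vs = n"
  shows "\<pi> n p (tens smul vs) \<le> prod_list (map p vs)"
  using tensor_seminorm_le_cost[OF assms(1), of n "tens smul vs" "[(1, vs)]"] assms
  by (simp add: represents_def cost_def)

lemma tensor_seminorm_triangle:
  assumes p: "seminorm p" and X: "X \<in> tensor_power smul n" and Y: "Y \<in> tensor_power smul n"
  shows "\<pi> n p (X + Y) \<le> \<pi> n p X + \<pi> n p Y"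
proof -
  have "\<pi> n p (X + Y) - \<pi> n p Y \<le> cost p xs" if xs: "represents smul n X xs" for xs
  proof -
    have "\<pi> n p (X + Y) - cost p xs \<le> cost p ys" if "represents smul n Y ys" for ys
      using tensor_seminorm_le_cost[OF p represents_append[OF xs that]] by (simp add: cost_append)
    from le_tensor_seminorm[OF Y this] show ?thesis by simp
  qed
  from le_tensor_seminorm[OF X this] show ?thesis by simp
qed

lemma tensor_seminorm_zero: "seminorm p \<Longrightarrow> \<pi> n p 0 = 0"
  using tensor_seminorm_le_cost[of p n 0 "[]"] tensor_seminorm_nonneg[of p 0 n]
    tensor.subspace_0[OF subspace_tensor_power]
  by (simp add: represents_def cost_def)

lemma tensor_seminorm_scale:
  assumes p: "seminorm p" and X: "X \<in> tensor_power smul n"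
  shows "\<pi> n p (tscale c X) = norm c * \<pi> n p X"
proof (cases "c = 0")
  case True
  then show ?thesis using tensor_seminorm_zero[OF p] by (simp only: tensor.scale_zero_left norm_zero mult_zero_left)
next
  case False
  have le: "\<pi> n p (tscale a Y) \<le> norm a * \<pi> n p Y"
    if a: "a \<noteq> 0" and Y: "Y \<in> tensor_power smul n" for a Y
  proof -
    have "\<pi> n p (tscale a Y) / norm a \<le> cost p xs" if "represents smul n Y xs" for xs
      using tensor_seminorm_le_cost[OF p represents_scale[OF that, of a]] a
      unfolding cost_scale by (simp add: divide_le_eq mult.commute)
    from le_tensor_seminorm[OF Y this] show ?thesis using a by (simp add: divide_le_eq mult.commute)
  qed
  have "\<pi> n p X = \<pi> n p (tscale (inverse c) (tscale c X))"
    using False by simp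
  also have "\<dots> \<le> norm (inverse c) * \<pi> n p (tscale c X)"
    using False X by (intro le tensor.subspace_scale[OF subspace_tensor_power]) auto
  finally have "norm c * \<pi> n p X \<le> \<pi> n p (tscale c X)"
    using False unfolding norm_inverse by (simp add: field_simps)
  with le[OF False X] show ?thesis by simp
qed

lemma tensor_seminorm_mono:
  assumes p: "seminorm p" and q: "seminorm q" and le: "\<And>x. p x \<le> q x" and X: "X \<in> tensor_power smul n"
  shows "\<pi> n p X \<le> \<pi> n q X"
proof (rule le_tensor_seminorm[OF X])
  fix xs assume "represents smul n X xs"
  then have "\<pi> n p X \<le> cost p xs" by (rule tensor_seminorm_le_cost[OF p])
  also have "\<dots> \<le> cost q xs"
    unfolding cost_def using le seminorm_nonneg[OF p]
    by (intro sum_list_mono) (auto intro!: mult_left_mono prod_list_mono)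
  finally show "\<pi> n p X \<le> cost q xs" .
qed

lemma tensor_seminorm_sum:
  assumes p: "seminorm p" and "\<And>i. i \<in> A \<Longrightarrow> f i \<in> tensor_power smul n"
  shows "\<pi> n p (\<Sum>i\<in>A. f i) \<le> (\<Sum>i\<in>A. \<pi> n p (f i))"
  using assms(2)
proof (induction A rule: infinite_finite_induct)
  case (insert a A)
  have "\<pi> n p (f a + (\<Sum>i\<in>A. f i)) \<le> \<pi> n p (f a) + \<pi> n p (\<Sum>i\<in>A. f i)"
    using insert.prems
    by (intro tensor_seminorm_triangle[OF p] tensor.subspace_sum[OF subspace_tensor_power]) auto
  also have "\<dots> \<le> \<pi> n p (f a) + (\<Sum>i\<in>A. \<pi> n p (f i))"
    using insert.IH insert.prems by simp
  finally show ?case by (simp only: sum.insert[OF insert.hyps])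
qed (simp_all add: tensor_seminorm_zero[OF p] fold_zero_fun)

text \<open>
  For homogeneous vectors each permutation yields one pure tensor up to a sign, so the bound has
  constant \<open>1\<close> for every \<open>p\<close>, whether or not \<open>p\<close> respects the grading.  For arbitrary vectors
  the decomposition into even and odd parts would enter the bound.
\<close>

lemma tensor_seminorm_symmetrizer:
  assumes p: "seminorm p" and vs: "homogeneous vs" "length vs = n"
  shows "\<pi> n p (\<S> n (tens smul vs)) \<le> prod_list (map p vs)"
proof -
  let ?f = "\<lambda>\<sigma>. tscale (koszul_sign V1 \<sigma> vs) (tens smul (permute_list \<sigma> vs))"
  have mem: "?f \<sigma> \<in> tensor_power smul n" for \<sigma>
    using tens_in_tensor_power[of "permute_list \<sigma> vs"] vs(2)
    by (intro tensor.subspace_scale[OF subspace_tensor_power]) simp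
  have "\<pi> n p (?f \<sigma>) \<le> prod_list (map p vs)" if \<sigma>: "\<sigma> permutes {..<n}" for \<sigma>
  proof -
    have "norm (koszul_sign V1 \<sigma> vs :: 'k) = 1"
      using koszul_sign_cases[of V1 \<sigma> vs, where 'k = 'k] by auto
    moreover have "tens smul (permute_list \<sigma> vs) \<in> tensor_power smul n"
      using tens_in_tensor_power[of "permute_list \<sigma> vs"] vs(2) by simp
    ultimately have "\<pi> n p (?f \<sigma>) = \<pi> n p (tens smul (permute_list \<sigma> vs))"
      by (simp add: tensor_seminorm_scale[OF p])
    also have "\<dots> \<le> prod_list (map p (permute_list \<sigma> vs))"
      using vs(2) by (intro tensor_seminorm_tens[OF p]) simp
    also have "\<dots> = prod_list (map p vs)"
    proof -
      have "mset (map p (permute_list \<sigma> vs)) = mset (map p vs)" using \<sigma> vs(2) by simp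
      then show ?thesis by (metis prod_mset_prod_list)
    qed
    finally show ?thesis .
  qed
  then have "(\<Sum>\<sigma> | \<sigma> permutes {..<n}. \<pi> n p (?f \<sigma>)) \<le> (\<Sum>\<sigma> | \<sigma> permutes {..<n}. prod_list (map p vs))"
    by (intro sum_mono) auto
  also have "\<dots> = fact n * prod_list (map p vs)"
    by (simp add: card_permutations)
  finally have "(\<Sum>\<sigma> | \<sigma> permutes {..<n}. \<pi> n p (?f \<sigma>)) \<le> fact n * prod_list (map p vs)" .
  moreover have "\<pi> n p (\<Sum>\<sigma> | \<sigma> permutes {..<n}. ?f \<sigma>) \<le>
      (\<Sum>\<sigma> | \<sigma> permutes {..<n}. \<pi> n p (?f \<sigma>))"
    by (intro tensor_seminorm_sum[OF p] mem)
  moreover have "\<pi> n p (\<S> n (tens smul vs)) =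
      norm (1 / fact n :: 'k) * \<pi> n p (\<Sum>\<sigma> | \<sigma> permutes {..<n}. ?f \<sigma>)"
    unfolding symmetrizer_tens[OF vs]
    by (intro tensor_seminorm_scale[OF p] tensor.subspace_sum[OF subspace_tensor_power] mem)
  ultimately show ?thesis
    by (simp add: norm_divide divide_le_eq mult.commute)
qed

end

section \<open>Words of coefficient functionals\<close>

lemma tensor_functional_add:
  "tensor_functional \<phi> u (X + Y) = tensor_functional \<phi> u X + tensor_functional \<phi> u Y"
  by (simp add: tensor_functional_def)

lemma tensor_functional_zero: "tensor_functional \<phi> u 0 = 0"
  by (simp add: tensor_functional_def)

lemma tensor_functional_scale: "tensor_functional \<phi> u (tscale c X) = c * tensor_functional \<phi> u X"
  by (simp add: tensor_functional_def tscale_def)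

lemma tensor_functional_sum:
  "tensor_functional \<phi> u (\<Sum>i\<in>A. f i) = (\<Sum>i\<in>A. tensor_functional \<phi> u (f i))"
proof (induction A rule: infinite_finite_induct)
  case (insert a A)
  then show ?case by (simp only: sum.insert[OF insert.hyps] tensor_functional_add)
qed (simp_all add: tensor_functional_zero fold_zero_fun)

lemma sum_words_of_products:
  fixes g :: "'i \<Rightarrow> 'v \<Rightarrow> 'a::comm_semiring_1"
  assumes "finite E"
  shows "(\<Sum>u | set u \<subseteq> E \<and> length u = length xs. prod_list (map2 g u xs)) =
    prod_list (map (\<lambda>x. \<Sum>i\<in>E. g i x) xs)"
proof (induction xs)
  case Nil
  have "{u. set u \<subseteq> E \<and> length u = length ([] :: 'v list)} = {[]}" by auto
  then show ?case by simp
next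
  case (Cons x xs)
  let ?L = "\<lambda>n. {u. set u \<subseteq> E \<and> length u = n}"
  have "(\<Sum>u\<in>?L (length (x # xs)). prod_list (map2 g u (x # xs))) =
      (\<Sum>(w, i)\<in>?L (length xs) \<times> E. prod_list (map2 g (i # w) (x # xs)))"
    by (simp add: lists_length_Suc_eq, subst sum.reindex) (auto simp: inj_on_def case_prod_unfold)
  also have "\<dots> = (\<Sum>w\<in>?L (length xs). \<Sum>i\<in>E. g i x * prod_list (map2 g w xs))"
    by (simp add: sum.cartesian_product)
  also have "\<dots> = (\<Sum>i\<in>E. g i x) * (\<Sum>w\<in>?L (length xs). prod_list (map2 g w xs))"
    by (simp add: sum_product sum.swap[of _ E])
  finally show ?case by (simp add: Cons.IH)
qed

context graded_locally_convex_space
begin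

lemma tensor_functional_tens:
  assumes lin: "\<And>i. i \<in> set u \<Longrightarrow> continuous_functional smul T (\<phi> i)" and len: "length vs = length u"
  shows "tensor_functional \<phi> u (tens smul vs) = prod_list (map2 \<phi> u vs)"
proof -
  have "multilinear smul (*) (length vs) (\<lambda>xs. prod_list (map2 \<phi> u xs))"
    unfolding multilinear_def
  proof (intro allI impI)
    fix xs :: "'v list" and i assume xs: "length xs = length vs" "i < length vs"
    have "prod_list (map2 \<phi> u (xs[i := x])) = \<phi> (u ! i) x * prod_list ((map2 \<phi> u xs)[i := 1])" for x
    proof -
      have "map2 \<phi> u (xs[i := x]) = (map2 \<phi> u xs)[i := \<phi> (u ! i) x]"
        using xs len by (intro nth_equalityI) (auto simp: nth_list_update)
      then show ?thesis using xs len prod_list_update[of i "map2 \<phi> u xs" "\<phi> (u ! i) x"] by simp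
    qed
    moreover have "continuous_functional smul T (\<phi> (u ! i))" using xs len by (intro lin) auto
    ultimately show "Vector_Spaces.linear smul (*) (\<lambda>x. prod_list (map2 \<phi> u (xs[i := x])))"
      by unfold_locales
        (auto simp: continuous_functional_def topspace_UNIV algebra_simps)
  qed
  then show ?thesis by (simp add: tensor_functional_def tens_def)
qed

text \<open>
  For a pure tensor the sum over all words factorises into the estimates for single vectors; for a
  general tensor it is therefore at most the cost of every representation, hence at most the
  infimum.
\<close>

lemma word_estimate:
  assumes p: "seminorm p" and q: "seminorm q"
    and \<phi>: "\<And>i. i \<in> I \<Longrightarrow> continuous_functional smul T (\<phi> i)"
    and est: "absolute_estimate UNIV I e \<phi> p q"
    and X: "X \<in> tensor_power smul n"
    and F: "finite F" "F \<subseteq> {u \<in> lists I. length u = n}"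
  shows "(\<Sum>u\<in>F. norm (tensor_functional \<phi> u X) * prod_list (map (\<lambda>i. p (e i)) u)) \<le> \<pi> n q X"
proof (rule le_tensor_seminorm[OF X])
  define E where "E = \<Union> (set ` F)"
  have E: "finite E" "E \<subseteq> I" "F \<subseteq> {u. set u \<subseteq> E \<and> length u = n}" using F by (auto simp: E_def)
  let ?a = "\<lambda>u. prod_list (map (\<lambda>i. p (e i)) u)"
  let ?g = "\<lambda>i x. norm (\<phi> i x) * p (e i)"
  have a0: "0 \<le> ?a u" for u by (intro prod_list_nonneg) (auto simp: seminorm_nonneg[OF p])
  have g0: "0 \<le> ?g i x" for i x by (simp add: seminorm_nonneg[OF p])
  have norm_prod: "norm (prod_list (map2 \<phi> u vs)) * ?a u = prod_list (map2 ?g u vs)"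
    if "length vs = length u" for u vs
    using that[symmetric] by (induction u vs rule: list_induct2) (auto simp: norm_mult)
  have pure: "(\<Sum>u\<in>F. norm (tensor_functional \<phi> u (tens smul vs)) * ?a u) \<le> prod_list (map q vs)"
    if vs: "length vs = n" for vs
  proof -
    have "(\<Sum>u\<in>F. norm (tensor_functional \<phi> u (tens smul vs)) * ?a u) = (\<Sum>u\<in>F. prod_list (map2 ?g u vs))"
    proof (rule sum.cong[OF refl])
      fix u assume "u \<in> F"
      then have u: "length vs = length u" "set u \<subseteq> I" using F vs by auto
      then show "norm (tensor_functional \<phi> u (tens smul vs)) * ?a u = prod_list (map2 ?g u vs)"
        using \<phi> by (subst tensor_functional_tens) (auto simp: norm_prod)
    qed
    also have "\<dots> \<le> (\<Sum>u | set u \<subseteq> E \<and> length u = length vs. prod_list (map2 ?g u vs))"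
      using E vs finite_lists_length_eq[OF E(1)] g0
      by (intro sum_mono2 prod_list_nonneg) auto
    also have "\<dots> = prod_list (map (\<lambda>x. \<Sum>i\<in>E. ?g i x) vs)" by (rule sum_words_of_products[OF E(1)])
    also have "\<dots> \<le> prod_list (map q vs)"
    proof (rule prod_list_mono)
      fix x assume "x \<in> set vs"
      have "(\<Sum>i\<in>E. ?g i x) \<le> (\<Sum>\<^sub>\<infinity>i\<in>I. ?g i x)"
        using est E g0 by (intro finite_sum_le_infsum) (auto simp: absolute_estimate_def)
      also have "\<dots> \<le> q x" using est by (auto simp: absolute_estimate_def)
      finally show "0 \<le> (\<Sum>i\<in>E. ?g i x) \<and> (\<Sum>i\<in>E. ?g i x) \<le> q x" using g0 by (simp add: sum_nonneg)
    qed
    finally show ?thesis .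
  qed
  fix xs assume "represents smul n X xs"
  then show "(\<Sum>u\<in>F. norm (tensor_functional \<phi> u X) * ?a u) \<le> cost q xs"
  proof (induction xs arbitrary: X)
    case Nil
    then have "X = 0" by (simp add: represents_def)
    then show ?case by (simp only: tensor_functional_zero cost_def) simp
  next
    case (Cons x xs)
    obtain c vs where x: "x = (c, vs)" by (cases x)
    let ?Y = "X - tscale c (tens smul vs)"
    have Y: "represents smul n ?Y xs" and vs: "length vs = n"
      using Cons.prems by (auto simp: represents_def x)
    have "X = tscale c (tens smul vs) + ?Y" by simp
    then have X: "tensor_functional \<phi> u X =
        c * tensor_functional \<phi> u (tens smul vs) + tensor_functional \<phi> u ?Y" for u
      by (metis tensor_functional_add tensor_functional_scale)
    have "(\<Sum>u\<in>F. norm (tensor_functional \<phi> u X) * ?a u) \<le>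
        (\<Sum>u\<in>F. norm c * (norm (tensor_functional \<phi> u (tens smul vs)) * ?a u) +
          norm (tensor_functional \<phi> u ?Y) * ?a u)"
    proof (rule sum_mono)
      fix u
      have "norm (tensor_functional \<phi> u X) \<le>
          norm c * norm (tensor_functional \<phi> u (tens smul vs)) + norm (tensor_functional \<phi> u ?Y)"
        unfolding X norm_mult[symmetric] by (rule norm_triangle_ineq)
      from mult_right_mono[OF this a0[of u]]
      show "norm (tensor_functional \<phi> u X) * ?a u \<le>
          norm c * (norm (tensor_functional \<phi> u (tens smul vs)) * ?a u) +
          norm (tensor_functional \<phi> u ?Y) * ?a u"
        by (simp only: distrib_right mult.assoc)
    qed
    also have "\<dots> = norm c * (\<Sum>u\<in>F. norm (tensor_functional \<phi> u (tens smul vs)) * ?a u) +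
        (\<Sum>u\<in>F. norm (tensor_functional \<phi> u ?Y) * ?a u)"
      by (simp only: sum.distrib sum_distrib_left)
    also have "\<dots> \<le> norm c * prod_list (map q vs) + cost q xs"
      by (intro add_mono mult_left_mono pure[OF vs] Cons.IH[OF Y]) simp
    finally show ?case by (simp add: x cost_def)
  qed
qed

end

section \<open>Weighted seminorms on the symmetric algebra\<close>

context graded_locally_convex_space
begin

abbreviation "\<A> \<equiv> sym_algebra smul V0 V1"

abbreviation "\<rho> p r \<equiv> weighted_seminorm smul p r"

lemma seminorm_zero_fun: "seminorm (\<lambda>_. 0)"
  by (simp add: continuous_seminorm_def)

lemma seminorm_add: "seminorm p \<Longrightarrow> seminorm q \<Longrightarrow> seminorm (\<lambda>x. p x + q x)"
  by (auto simp: continuous_seminorm_def topspace_UNIV algebra_simps add_mono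
      intro: continuous_map_add) (smt (verit, best))

lemma seminorm_norm: "continuous_functional smul T f \<Longrightarrow> seminorm (\<lambda>x. norm (f x))"
  by (auto simp: continuous_functional_def continuous_seminorm_def topspace_UNIV norm_mult
      intro: norm_triangle_ineq continuous_map_norm)

lemma seminorm_sum_functionals:
  assumes "\<And>i. i \<in> A \<Longrightarrow> continuous_functional smul T (f i)"
  shows "seminorm (\<lambda>x. \<Sum>i\<in>A. norm (f i x))"
  using assms
proof (induction A rule: infinite_finite_induct)
  case (insert a A)
  then show ?case by (simp add: seminorm_add seminorm_norm)
qed (simp_all add: seminorm_zero_fun)

lemma sym_algebra_component: "v \<in> \<A> \<Longrightarrow> v n \<in> tensor_power smul n"
  using sym_power_subset by (auto simp: sym_algebra_def)

lemma sym_algebra_finite: "v \<in> \<A> \<Longrightarrow> finite {n. v n \<noteq> 0}"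
  by (simp add: sym_algebra_def)

lemma weighted_seminorm_superset:
  assumes "seminorm p" "finite N" "{n. v n \<noteq> 0} \<subseteq> N"
  shows "\<rho> p r v = (\<Sum>n\<in>N. \<pi> n p (v n) * fact n powr r)"
  unfolding weighted_seminorm_def
  using assms by (intro sum.mono_neutral_left) (auto simp: tensor_seminorm_zero)

lemma weighted_seminorm_nonneg: "seminorm p \<Longrightarrow> v \<in> \<A> \<Longrightarrow> 0 \<le> \<rho> p r v"
  unfolding weighted_seminorm_def
  by (intro sum_nonneg mult_nonneg_nonneg tensor_seminorm_nonneg sym_algebra_component) auto

lemma weighted_seminorm_triangle:
  assumes p: "seminorm p" and x: "x \<in> \<A>" and y: "y \<in> \<A>"
  shows "\<rho> p r (x + y) \<le> \<rho> p r x + \<rho> p r y"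
proof -
  let ?N = "{n. x n \<noteq> 0} \<union> {n. y n \<noteq> 0}"
  have N: "finite ?N" using x y by (simp add: sym_algebra_finite)
  have "\<rho> p r (x + y) = (\<Sum>n\<in>?N. \<pi> n p (x n + y n) * fact n powr r)"
    by (subst weighted_seminorm_superset[OF p N]) auto
  also have "\<dots> \<le> (\<Sum>n\<in>?N. \<pi> n p (x n) * fact n powr r + \<pi> n p (y n) * fact n powr r)"
    unfolding distrib_right[symmetric]
    by (intro sum_mono mult_right_mono tensor_seminorm_triangle[OF p] sym_algebra_component x y) auto
  also have "\<dots> = \<rho> p r x + \<rho> p r y"
    using weighted_seminorm_superset[OF p N, of x r] weighted_seminorm_superset[OF p N, of y r]
    by (auto simp: sum.distrib)
  finally show ?thesis .
qed

lemma weighted_seminorm_scale: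
  assumes p: "seminorm p" and x: "x \<in> \<A>"
  shows "\<rho> p r (sscale c x) = norm c * \<rho> p r x"
proof -
  let ?N = "{n. x n \<noteq> 0}"
  have "\<rho> p r (sscale c x) = (\<Sum>n\<in>?N. \<pi> n p (tscale c (x n)) * fact n powr r)"
    using weighted_seminorm_superset[OF p sym_algebra_finite[OF x], of "sscale c x" r]
    by (auto simp: sscale_def)
  also have "\<dots> = norm c * \<rho> p r x"
    unfolding weighted_seminorm_def sum_distrib_left
    by (intro sum.cong refl)
       (simp only: tensor_seminorm_scale[OF p sym_algebra_component[OF x]] mult.assoc)
  finally show ?thesis .
qed

lemma weighted_seminorm_mono:
  assumes p: "seminorm p" and q: "seminorm q" and le: "\<And>x. p x \<le> q x" "r \<le> s" and v: "v \<in> \<A>"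
  shows "\<rho> p r v \<le> \<rho> q s v"
  unfolding weighted_seminorm_def
proof (rule sum_mono)
  fix n
  have "(fact n :: real) powr r \<le> fact n powr s" using le(2) by (intro powr_mono) (auto simp: fact_ge_1)
  moreover have "\<pi> n p (v n) \<le> \<pi> n q (v n)"
    by (rule tensor_seminorm_mono[OF p q le(1) sym_algebra_component[OF v]])
  ultimately show "\<pi> n p (v n) * fact n powr r \<le> \<pi> n q (v n) * fact n powr s"
    using tensor_seminorm_nonneg[OF q sym_algebra_component[OF v]] by (intro mult_mono) auto
qed

text \<open>
  The single exponent \<open>R\<close> gives the topology of the symmetric algebra, the exponents below \<open>R\<close> give
  that of the Weyl algebra; both are treated at once as a family with arbitrary exponents.
\<close>

definition weighted_family :: "real set \<Rightarrow> (('k, 'v) tensors \<Rightarrow> real) set" where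
  "weighted_family S = {\<rho> p r | p r. seminorm p \<and> r \<in> S}"

text \<open>
  Since \<open>n! \<ge> 1\<close>, the weights grow with the exponent; the sum of two seminorms together with
  the larger exponent therefore dominates both.
\<close>

lemma directed_weighted_family:
  assumes "S \<noteq> {}"
  shows "directed_seminorms sscale \<A> (weighted_family S)"
proof unfold_locales
  show "tensors.subspace \<A>" by (rule subspace_sym_algebra)
  show "weighted_family S \<noteq> {}" using assms seminorm_zero_fun by (auto simp: weighted_family_def)
next
  fix p and x y :: "('k, 'v) tensors" assume "p \<in> weighted_family S" "x \<in> \<A>" "y \<in> \<A>"
  then show "p (x + y) \<le> p x + p y"
    unfolding weighted_family_def using weighted_seminorm_triangle by blast
next
  fix p c and x :: "('k, 'v) tensors" assume "p \<in> weighted_family S" "x \<in> \<A>"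
  then show "p (sscale c x) = norm c * p x"
    unfolding weighted_family_def using weighted_seminorm_scale by blast
next
  fix P Q :: "('k, 'v) tensors \<Rightarrow> real" assume "P \<in> weighted_family S" "Q \<in> weighted_family S"
  then obtain p r q s where P: "P = \<rho> p r" "seminorm p" "r \<in> S" and Q: "Q = \<rho> q s" "seminorm q" "s \<in> S"
    unfolding weighted_family_def by blast
  let ?R = "\<rho> (\<lambda>x. p x + q x) (max r s)"
  have "?R \<in> weighted_family S"
    unfolding weighted_family_def using seminorm_add[OF P(2) Q(2)] P(3) Q(3)
    by (intro CollectI exI[of _ "\<lambda>x. p x + q x"] exI[of _ "max r s"]) (auto simp: max_def)
  moreover have "P x \<le> ?R x \<and> Q x \<le> ?R x" if "x \<in> \<A>" for x
    unfolding P(1) Q(1) using that P(2) Q(2) seminorm_nonneg seminorm_add[OF P(2) Q(2)]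
    by (intro conjI weighted_seminorm_mono) auto
  ultimately show "\<exists>R\<in>weighted_family S. \<forall>x\<in>\<A>. P x \<le> R x \<and> Q x \<le> R x" by blast
qed

lemma sym_topology_family: "sym_topology smul T V0 V1 R = seminorm_topology \<A> (weighted_family {R})"
  unfolding sym_topology_def weighted_family_def by (intro arg_cong2[where f = seminorm_topology]) auto

lemma weyl_minus_topology_family:
  "weyl_minus_topology smul T V0 V1 R = seminorm_topology \<A> (weighted_family {..<R})"
proof -
  have "{\<rho> p (R - \<epsilon>) | p \<epsilon>. seminorm p \<and> 0 < \<epsilon>} = weighted_family {..<R}"
    unfolding weighted_family_def
  proof (intro set_eqI iffI)
    fix f assume "f \<in> {\<rho> p (R - \<epsilon>) | p \<epsilon>. seminorm p \<and> 0 < \<epsilon>}"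
    then obtain p \<epsilon> where "f = \<rho> p (R - \<epsilon>)" "seminorm p" "0 < \<epsilon>" by blast
    then show "f \<in> {\<rho> p r | p r. seminorm p \<and> r \<in> {..<R}}"
      by (intro CollectI exI[of _ p] exI[of _ "R - \<epsilon>"]) auto
  next
    fix f assume "f \<in> {\<rho> p r | p r. seminorm p \<and> r \<in> {..<R}}"
    then obtain p r where "f = \<rho> p r" "seminorm p" "r < R" by blast
    then show "f \<in> {\<rho> p (R - \<epsilon>) | p \<epsilon>. seminorm p \<and> 0 < \<epsilon>}"
      by (intro CollectI exI[of _ p] exI[of _ "R - r"]) auto
  qed
  then show ?thesis unfolding weyl_minus_topology_def by simp
qed

end

section \<open>Density of the monomials\<close>

locale homogeneous_basis = graded_locally_convex_space smul T V0 V1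
  for smul :: "'k::real_normed_field \<Rightarrow> 'v::ab_group_add \<Rightarrow> 'v" and T V0 V1 +
  fixes I :: "'i set" and e :: "'i \<Rightarrow> 'v" and \<phi> :: "'i \<Rightarrow> 'v \<Rightarrow> 'k"
  assumes basis: "absolute_schauder_basis smul T I e \<phi>"
    and homogeneous_e: "\<forall>i\<in>I. e i \<in> V0 \<union> V1"
begin

lemma functional: "i \<in> I \<Longrightarrow> continuous_functional smul T (\<phi> i)"
  using basis by (simp add: absolute_schauder_basis_def)

lemma functional_e: "i \<in> I \<Longrightarrow> j \<in> I \<Longrightarrow> \<phi> i (e j) = (if i = j then 1 else 0)"
  using basis by (simp add: absolute_schauder_basis_def)

lemma homogeneous_word: "u \<in> lists I \<Longrightarrow> homogeneous (map e u)"
  using homogeneous_e by auto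

lemma seminorm_comp:
  assumes p: "seminorm p" and Q: "Vector_Spaces.linear smul smul Q" "continuous_map T T Q"
  shows "seminorm (\<lambda>x. p (Q x))"
proof -
  interpret Q: Vector_Spaces.linear smul smul Q by (rule Q(1))
  have "continuous_map T euclidean (p \<circ> Q)"
    using Q(2) p by (intro continuous_map_compose[of T T]) (auto simp: continuous_seminorm_def)
  then show ?thesis
    using seminorm_triangle[OF p] seminorm_scale[OF p]
    by (auto simp: continuous_seminorm_def topspace_UNIV Q.add Q.scale o_def)
qed

lemma partial_sums_converge:
  assumes p: "seminorm p" and \<epsilon>: "0 < \<epsilon>"
  shows "\<exists>F. finite F \<and> F \<subseteq> I \<and> p (x - (\<Sum>i\<in>F. smul (\<phi> i x) (e i))) < \<epsilon>"
proof -
  have "continuous_map T (prod_topology euclidean T) (\<lambda>y. (- 1 :: 'k, y))"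
    by (intro continuous_map_pairedI) auto
  from continuous_map_compose[OF this continuous_scale]
  have "continuous_map T T (\<lambda>y. - y)" by (simp add: o_def)
  then have "continuous_map T (prod_topology T T) (\<lambda>y. (x, - y))"
    by (intro continuous_map_pairedI) (auto simp: topspace_UNIV)
  from continuous_map_compose[OF this continuous_add]
  have "continuous_map T T (\<lambda>y. x - y)" by (simp add: o_def)
  moreover have "continuous_map T euclideanreal p" using p by (simp add: continuous_seminorm_def)
  ultimately have "continuous_map T euclideanreal (\<lambda>y. p (x - y))"
    using continuous_map_compose[of T T "\<lambda>y. x - y" euclideanreal p] by (simp add: o_def)
  then have op: "openin T {y \<in> topspace T. p (x - y) \<in> {..<\<epsilon>}}"
    by (intro openin_continuous_map_preimage[of _ euclideanreal]) auto
  have "p 0 = 0" using seminorm_scale[OF p, of 0 0] by simp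
  then have "x \<in> {y \<in> topspace T. p (x - y) \<in> {..<\<epsilon>}}" using \<epsilon> by (simp add: topspace_UNIV)
  moreover have "limitin T (\<lambda>F. \<Sum>i\<in>F. smul (\<phi> i x) (e i)) x (finite_subsets_at_top I)"
    using basis by (simp add: absolute_schauder_basis_def topspace_UNIV)
  ultimately have "\<forall>\<^sub>F F in finite_subsets_at_top I.
      (\<Sum>i\<in>F. smul (\<phi> i x) (e i)) \<in> {y \<in> topspace T. p (x - y) \<in> {..<\<epsilon>}}"
    using op unfolding limitin_def by blast
  then obtain F where F: "finite F" "F \<subseteq> I" and *: "\<And>Y. finite Y \<and> F \<subseteq> Y \<and> Y \<subseteq> I \<Longrightarrow>
      (\<Sum>i\<in>Y. smul (\<phi> i x) (e i)) \<in> {y \<in> topspace T. p (x - y) \<in> {..<\<epsilon>}}"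
    unfolding eventually_finite_subsets_at_top by blast
  from *[of F] F show ?thesis by auto
qed

text \<open>
  The projection to the even part keeps or removes each basis vector, so it maps the partial sums of
  the expansion of an even vector \<open>x\<close> into the span of the basis vectors; by its continuity the
  projected sums still approximate \<open>x\<close>.  The error is then even as well.  Odd vectors are treated
  alike.
\<close>

lemma homogeneous_approximation:
  assumes p: "seminorm p" and x: "x \<in> V0 \<union> V1" and \<epsilon>: "0 < \<epsilon>"
  shows "\<exists>y\<in>span (e ` I). y \<in> V0 \<union> V1 \<and> x - y \<in> V0 \<union> V1 \<and> p (x - y) < \<epsilon>"
proof -
  have *: "\<exists>y\<in>span (e ` I). y \<in> U \<and> x - y \<in> U \<and> p (x - y) < \<epsilon>"
    if U: "subspace U" "x \<in> U" and Q: "Vector_Spaces.linear smul smul Q" "continuous_map T T Q" "Q x = x"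
      and e: "\<And>i. i \<in> I \<Longrightarrow> Q (e i) = 0 \<or> Q (e i) = e i \<and> e i \<in> U" for Q U
  proof -
    interpret Q: Vector_Spaces.linear smul smul Q by (rule Q(1))
    obtain F where F: "finite F" "F \<subseteq> I" "p (Q (x - (\<Sum>i\<in>F. smul (\<phi> i x) (e i)))) < \<epsilon>"
      using partial_sums_converge[OF seminorm_comp[OF p Q(1,2)] \<epsilon>] by blast
    let ?y = "\<Sum>i\<in>F. smul (\<phi> i x) (Q (e i))"
    have "Q (x - (\<Sum>i\<in>F. smul (\<phi> i x) (e i))) = x - ?y"
      by (simp add: Q.diff Q.sum Q.scale Q(3))
    moreover have "?y \<in> U"
    proof (intro subspace_sum[OF U(1)] subspace_scale[OF U(1)])
      fix i assume "i \<in> F"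
      then have "i \<in> I" using F(2) by blast
      from e[OF this] show "Q (e i) \<in> U" using subspace_0[OF U(1)] by auto
    qed
    moreover have "?y \<in> span (e ` I)"
    proof (intro span_sum span_scale)
      fix i assume "i \<in> F"
      then have i: "i \<in> I" using F(2) by blast
      from e[OF i] show "Q (e i) \<in> span (e ` I)" using span_zero span_base[OF imageI[OF i]] by auto
    qed
    ultimately show ?thesis using F(3) subspace_diff[OF U] by auto
  qed
  from x show ?thesis
  proof
    assume x: "x \<in> V0"
    have "\<exists>y\<in>span (e ` I). y \<in> V0 \<and> x - y \<in> V0 \<and> p (x - y) < \<epsilon>"
      using homogeneous_e projection_along_props
      x by (intro *[OF subspace_even x projection_along_props(1) continuous_even]) auto
    then show ?thesis by blast
  next
    assume x: "x \<in> V1"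
    have "\<exists>y\<in>span (e ` I). y \<in> V1 \<and> x - y \<in> V1 \<and> p (x - y) < \<epsilon>"
      using homogeneous_e projection_along_props
      x by (intro *[OF subspace_odd x projection_along_props(2) continuous_odd]) auto
    then show ?thesis by blast
  qed
qed

abbreviation "monomials n \<equiv> {\<S> n (tens smul (map e u)) | u. u \<in> lists I \<and> length u = n}"

lemma monomials_span_subset: "tensor.span (monomials n) \<subseteq> sym_power smul V0 V1 n"
  by (rule tensor.span_minimal) (auto simp: subspace_sym_power symmetrizer_tens_in_sym_power)

text \<open>
  The factors are replaced one at a time by approximations in the span of the basis vectors.  All
  intermediate tensors are pure with homogeneous factors, so that the symmetrizer does not increase
  the bound for the error.
\<close>

lemma symmetrizer_tens_approximation:
  assumes p: "seminorm p" and xs: "homogeneous xs" "length xs = n" and \<epsilon>: "0 < \<epsilon>"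
  shows "\<exists>Y\<in>tensor.span (monomials n). \<pi> n p (\<S> n (tens smul xs) - Y) < \<epsilon>"
proof -
  have "\<exists>ys. homogeneous ys \<and> length ys = n \<and> (\<forall>i<k. ys ! i \<in> span (e ` I)) \<and>
      \<pi> n p (\<S> n (tens smul xs - tens smul ys)) < \<epsilon>"
    if "k \<le> n" "0 < \<epsilon>" for k and \<epsilon> :: real
    using that
  proof (induction k arbitrary: \<epsilon>)
    case 0
    then show ?case
      using xs
      by (intro exI[of _ xs]) (simp only: diff_self symmetrizer_zero tensor_seminorm_zero[OF p], simp)
  next
    case (Suc k)
    have "k \<le> n" "0 < \<epsilon> / 2" using Suc.prems by auto
    from Suc.IH[OF this] obtain ys where
      "homogeneous ys \<and> length ys = n \<and> (\<forall>i<k. ys ! i \<in> span (e ` I)) \<and>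
        \<pi> n p (\<S> n (tens smul xs - tens smul ys)) < \<epsilon> / 2" by (rule exE)
    then have ys: "homogeneous ys" "length ys = n" "\<And>i. i < k \<Longrightarrow> ys ! i \<in> span (e ` I)"
      "\<pi> n p (\<S> n (tens smul xs - tens smul ys)) < \<epsilon> / 2" by blast+
    have k: "k < length ys" using Suc.prems ys(2) by simp
    \<comment> \<open>the contribution of the factors that are not replaced in this step\<close>
    define C where "C = prod_list ((map p ys)[k := 1])"
    have C: "0 \<le> C"
      unfolding C_def
    proof (rule prod_list_nonneg)
      fix x assume "x \<in> set ((map p ys)[k := 1])"
      then have "x = 1 \<or> x \<in> p ` set ys"
        using set_update_subset_insert[of "map p ys" k 1] by auto
      then show "0 \<le> x" using seminorm_nonneg[OF p] by auto
    qed
    have "ys ! k \<in> V0 \<union> V1" using ys(1) nth_mem[OF k] by (rule subsetD)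
    then obtain y where y: "y \<in> span (e ` I)" "y \<in> V0 \<union> V1" "ys ! k - y \<in> V0 \<union> V1"
      "p (ys ! k - y) < \<epsilon> / 2 / (C + 1)"
      using homogeneous_approximation[OF p, of "ys ! k" "\<epsilon> / 2 / (C + 1)"] C Suc.prems by auto
    let ?zs = "ys[k := y]" and ?ds = "ys[k := ys ! k - y]"
    have hom: "homogeneous ?zs" "homogeneous ?ds"
      using set_update_subset_insert[of ys k] ys(1) y(2,3) by (meson insert_subset subset_trans)+
    have "tens smul ?ds = tens smul ys - tens smul ?zs"
      using tens_update_diff[OF k, of "ys ! k" y] by simp
    then have "tens smul xs - tens smul ?zs = (tens smul xs - tens smul ys) + tens smul ?ds"
      by simp
    then have split: "\<S> n (tens smul xs - tens smul ?zs) =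
        \<S> n (tens smul xs - tens smul ys) + \<S> n (tens smul ?ds)"
      by (simp only: symmetrizer_add)
    have mem: "tens smul xs \<in> tensor_power smul n" "tens smul ys \<in> tensor_power smul n"
      "tens smul ?ds \<in> tensor_power smul n"
      using tens_in_tensor_power[of xs] tens_in_tensor_power[of ys] tens_in_tensor_power[of ?ds] xs(2) ys(2)
      by simp_all
    have "\<pi> n p (\<S> n (tens smul xs - tens smul ?zs)) \<le>
        \<pi> n p (\<S> n (tens smul xs - tens smul ys)) + \<pi> n p (\<S> n (tens smul ?ds))"
      unfolding split
      by (intro tensor_seminorm_triangle[OF p] symmetrizer_in_tensor_power
          tensor.subspace_diff[OF subspace_tensor_power] mem)
    moreover have "\<pi> n p (\<S> n (tens smul ?ds)) \<le> prod_list (map p ?ds)"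
      using ys(2) by (intro tensor_seminorm_symmetrizer[OF p hom(2)]) simp
    moreover have "prod_list (map p ?ds) = p (ys ! k - y) * C"
      unfolding C_def map_update using k by (intro prod_list_update) simp
    moreover have "p (ys ! k - y) * C \<le> (\<epsilon> / 2 / (C + 1)) * (C + 1)"
      using y(4) C seminorm_nonneg[OF p, of "ys ! k - y"] by (intro mult_mono; linarith)
    moreover have "(\<epsilon> / 2 / (C + 1)) * (C + 1) = \<epsilon> / 2"
      using C by (simp add: field_simps)
    ultimately have small: "\<pi> n p (\<S> n (tens smul xs - tens smul ?zs)) < \<epsilon>"
      using ys(4) by linarith
    have letters: "?zs ! i \<in> span (e ` I)" if "i < Suc k" for i
      using that ys(3) y(1) k by (cases "i = k") auto
    have "length ?zs = n" using ys(2) by simp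
    then show ?case
      by (intro exI[of _ ?zs] conjI allI impI hom(1) small letters)
  qed
  from this[OF order_refl \<epsilon>] obtain ys where
    "homogeneous ys \<and> length ys = n \<and> (\<forall>i<n. ys ! i \<in> span (e ` I)) \<and>
      \<pi> n p (\<S> n (tens smul xs - tens smul ys)) < \<epsilon>" by (rule exE)
  then have ys: "length ys = n" "\<forall>i<n. ys ! i \<in> span (e ` I)"
    "\<pi> n p (\<S> n (tens smul xs - tens smul ys)) < \<epsilon>" by blast+
  have "set ys \<subseteq> span (e ` I)" using ys(1,2) by (auto simp: set_conv_nth)
  then have "tens smul ys \<in> tensor.span {tens smul ws | ws. length ws = n \<and> set ws \<subseteq> e ` I}"
    using tens_in_span[of ys "e ` I"] ys(1) by simp
  then have image: "\<S> n (tens smul ys) \<in>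
      tensor.span (\<S> n ` {tens smul ws | ws. length ws = n \<and> set ws \<subseteq> e ` I})"
    using tensor_endo.linear_span_image[OF linear_symmetrizer] by blast
  have subset: "\<S> n ` {tens smul ws | ws. length ws = n \<and> set ws \<subseteq> e ` I} \<subseteq> monomials n"
  proof
    fix Y assume "Y \<in> \<S> n ` {tens smul ws | ws. length ws = n \<and> set ws \<subseteq> e ` I}"
    then obtain ws where ws: "Y = \<S> n (tens smul ws)" "length ws = n" "ws \<in> lists (e ` I)" by auto
    then obtain u where "ws = map e u" "u \<in> lists I" unfolding lists_image by blast
    with ws show "Y \<in> monomials n" by auto
  qed
  show ?thesis
    using ys(3) subsetD[OF tensor.span_mono[OF subset] image] unfolding symmetrizer_diff
    by (rule bexI)
qed

lemma symmetrizer_approximation: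
  assumes p: "seminorm p" and X: "X \<in> tensor_power smul n" and \<epsilon>: "0 < \<epsilon>"
  shows "\<exists>Y\<in>tensor.span (monomials n). \<pi> n p (\<S> n X - Y) < \<epsilon>"
proof -
  have "X \<in> tensor_power smul n \<and>
      (\<forall>\<epsilon>>0. \<exists>Y\<in>tensor.span (monomials n). \<pi> n p (\<S> n X - Y) < \<epsilon>)"
    using X[unfolded tensor_power_homogeneous]
  proof (induction X rule: tensor.span_induct_alt)
    case base
    show ?case
      using tensor_seminorm_zero[OF p, of n] tensor.span_zero tensor.subspace_0[OF subspace_tensor_power]
      by (intro conjI allI impI bexI[of _ 0]) (simp_all only: symmetrizer_zero diff_zero)
  next
    case (step c x y)
    then obtain vs where vs: "x = tens smul vs" "length vs = n" "homogeneous vs" by auto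
    have xy: "x \<in> tensor_power smul n" "y \<in> tensor_power smul n"
      using vs tens_in_tensor_power step.IH by blast+
    have "\<exists>Y\<in>tensor.span (monomials n). \<pi> n p (\<S> n (tscale c x + y) - Y) < \<epsilon>" if \<epsilon>: "0 < \<epsilon>" for \<epsilon>
    proof -
      have "0 < \<epsilon> / 2" using \<epsilon> by simp
      with step.IH have "\<exists>Z\<in>tensor.span (monomials n). \<pi> n p (\<S> n y - Z) < \<epsilon> / 2" by blast
      then obtain Z where
        Z: "Z \<in> tensor.span (monomials n)" "\<pi> n p (\<S> n y - Z) < \<epsilon> / 2" by (rule bexE)
      have "0 < \<epsilon> / 2 / (norm c + 1)" using \<epsilon> by (simp add: add_nonneg_pos)
      from symmetrizer_tens_approximation[OF p vs(3,2) this, folded vs(1)] obtain Y where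
        Y: "Y \<in> tensor.span (monomials n)" "\<pi> n p (\<S> n x - Y) < \<epsilon> / 2 / (norm c + 1)"
        by (rule bexE)
      have YZ: "Y \<in> tensor_power smul n" "Z \<in> tensor_power smul n"
        using Y(1) Z(1) monomials_span_subset sym_power_subset by blast+
      note mem = tensor.subspace_diff[OF subspace_tensor_power symmetrizer_in_tensor_power[OF xy(1)] YZ(1)]
        tensor.subspace_diff[OF subspace_tensor_power symmetrizer_in_tensor_power[OF xy(2)] YZ(2)]
      have split: "\<S> n (tscale c x + y) - (tscale c Y + Z) = tscale c (\<S> n x - Y) + (\<S> n y - Z)"
        by (simp only: symmetrizer_add symmetrizer_scale tensor.scale_right_diff_distrib add_diff_add)
      have "\<pi> n p (\<S> n (tscale c x + y) - (tscale c Y + Z)) \<le>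
          \<pi> n p (tscale c (\<S> n x - Y)) + \<pi> n p (\<S> n y - Z)"
        unfolding split
        by (intro tensor_seminorm_triangle[OF p] tensor.subspace_scale[OF subspace_tensor_power] mem)
      moreover have "\<pi> n p (tscale c (\<S> n x - Y)) = norm c * \<pi> n p (\<S> n x - Y)"
        by (rule tensor_seminorm_scale[OF p mem(1)])
      moreover have "norm c * \<pi> n p (\<S> n x - Y) \<le> (norm c + 1) * (\<epsilon> / 2 / (norm c + 1))"
        using Y(2) tensor_seminorm_nonneg[OF p mem(1)] by (intro mult_mono) simp_all
      moreover have "(norm c + 1) * (\<epsilon> / 2 / (norm c + 1)) = \<epsilon> / 2"
        using norm_ge_zero[of c] by (subst times_divide_eq_right, intro nonzero_mult_div_cancel_left) linarith
      ultimately have "\<pi> n p (\<S> n (tscale c x + y) - (tscale c Y + Z)) < \<epsilon>"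
        using Z(2) by linarith
      then show ?thesis
        using Y(1) Z(1) by (intro bexI[of _ "tscale c Y + Z"]) (simp_all only: tensor.span_add tensor.span_scale)
    qed
    with xy show ?case
      by (intro conjI allI impI tensor.subspace_add[OF subspace_tensor_power]
          tensor.subspace_scale[OF subspace_tensor_power])
  qed
  with \<epsilon> show ?thesis by blast
qed

abbreviation "monomial \<equiv> sym_monomial smul V0 V1 e"

lemma homogeneous_component_in_span:
  assumes "Y \<in> tensor.span (monomials n)"
  shows "(\<lambda>k. if k = n then Y else 0) \<in> tensors.span (monomial ` lists I)"
  using assms
proof (induction rule: tensor.span_induct_alt)
  case base
  have "(\<lambda>k. if k = n then 0 else 0 :: ('k, 'v) tensor) = 0" by (auto simp: fun_eq_iff)
  then show ?case by (simp only: tensors.span_zero)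
next
  case (step c x y)
  then obtain u where u: "u \<in> lists I" "length u = n" "x = \<S> n (tens smul (map e u))" by blast
  have eq: "(\<lambda>k. if k = n then tscale c x + y else 0) = sscale c (monomial u) + (\<lambda>k. if k = n then y else 0)"
    using u by (auto simp: fun_eq_iff sscale_def sym_monomial_def tscale_def)
  show ?case
    unfolding eq
    by (intro tensors.span_add tensors.span_scale tensors.span_base imageI step.IH u(1))
qed

text \<open>
  Symmetrizing an approximation of a tensor by products of basis vectors gives an approximation of
  its symmetrization by monomials; an element of the symmetric algebra is its own symmetrization and
  has finitely many components.
\<close>

lemma monomials_dense:
  assumes p: "seminorm p" and v: "v \<in> \<A>" and \<epsilon>: "0 < \<epsilon>"
  shows "\<exists>w\<in>tensors.span (monomial ` lists I). \<rho> p r (v - w) < \<epsilon>"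
proof -
  define N where "N = {n. v n \<noteq> 0}"
  have N: "finite N" unfolding N_def by (rule sym_algebra_finite[OF v])
  let ?\<epsilon> = "\<lambda>n. \<epsilon> / ((card N + 1) * fact n powr r)"
  have "\<forall>n. \<exists>Y. Y \<in> tensor.span (monomials n) \<and> \<pi> n p (v n - Y) < ?\<epsilon> n"
  proof
    fix n
    have "v n \<in> sym_power smul V0 V1 n" using v by (simp add: sym_algebra_def)
    moreover from this have "\<S> n (v n) = v n" by (rule symmetrizer_sym_power)
    moreover have "0 < ?\<epsilon> n" using \<epsilon> by (intro divide_pos_pos mult_pos_pos) auto
    ultimately show "\<exists>Y. Y \<in> tensor.span (monomials n) \<and> \<pi> n p (v n - Y) < ?\<epsilon> n"
      using symmetrizer_approximation[OF p sym_algebra_component[OF v], of "?\<epsilon> n" n]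
      by (simp only: Bex_def)
  qed
  from choice[OF this] obtain Y where
    Y': "\<forall>n. Y n \<in> tensor.span (monomials n) \<and> \<pi> n p (v n - Y n) < ?\<epsilon> n" by (rule exE)
  then have Y: "\<And>n. Y n \<in> tensor.span (monomials n)" "\<And>n. \<pi> n p (v n - Y n) < ?\<epsilon> n"
    by blast+
  define w where "w = (\<Sum>n\<in>N. (\<lambda>k. if k = n then Y n else 0))"
  have wn: "w k = (if k \<in> N then Y k else 0)" for k
  proof -
    have "w k = (\<Sum>n\<in>N. if k = n then Y n else 0)"
      unfolding w_def using N by (induction N rule: finite_induct) auto
    then show ?thesis using N by (simp add: sum.delta)
  qed
  have "\<rho> p r (v - w) = (\<Sum>n\<in>N. \<pi> n p ((v - w) n) * fact n powr r)"
    by (rule weighted_seminorm_superset[OF p N]) (auto simp: wn N_def)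
  also have "\<dots> = (\<Sum>n\<in>N. \<pi> n p (v n - Y n) * fact n powr r)"
    by (rule sum.cong) (simp_all add: wn)
  also have "\<dots> \<le> (\<Sum>n\<in>N. \<epsilon> / (card N + 1))"
  proof (rule sum_mono)
    fix n
    have "\<pi> n p (v n - Y n) * fact n powr r \<le> ?\<epsilon> n * fact n powr r"
      using Y(2)[of n] by (intro mult_right_mono) auto
    also have "\<dots> = \<epsilon> / (card N + 1)" by simp
    finally show "\<pi> n p (v n - Y n) * fact n powr r \<le> \<epsilon> / (card N + 1)" .
  qed
  also have "\<dots> = \<epsilon> * (card N / (card N + 1))" by simp
  also have "\<dots> < \<epsilon>" using \<epsilon> by (simp add: field_simps)
  finally have "\<rho> p r (v - w) < \<epsilon>" .
  moreover have "w \<in> tensors.span (monomial ` lists I)"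
    unfolding w_def by (intro tensors.span_sum homogeneous_component_in_span Y(1))
  ultimately show ?thesis by blast
qed

end

section \<open>Permuting words\<close>

definition stabilizer :: "'i list \<Rightarrow> (nat \<Rightarrow> nat) set" where
  "stabilizer u = {\<sigma>. \<sigma> permutes {..<length u} \<and> permute_list \<sigma> u = u}"

definition orbit :: "'i list \<Rightarrow> 'i list set" where
  "orbit u = (\<lambda>\<sigma>. permute_list \<sigma> u) ` {\<sigma>. \<sigma> permutes {..<length u}}"

lemma finite_orbit: "finite (orbit u)"
  by (simp add: orbit_def finite_permutations)

lemma orbit_subset_lists: "u \<in> lists I \<Longrightarrow> orbit u \<subseteq> lists I"
  by (auto simp: orbit_def)

lemma card_orbit_stabilizer: "card (orbit u) * card (stabilizer u) = fact (length u)"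
proof -
  let ?P = "{\<sigma>. \<sigma> permutes {..<length u}}"
  have fin: "finite ?P" by (rule finite_permutations) simp
  have fibre: "card {\<sigma> \<in> ?P. permute_list \<sigma> u = w} = card (stabilizer u)" if w: "w \<in> orbit u" for w
  proof -
    obtain \<tau> where \<tau>: "\<tau> permutes {..<length u}" "w = permute_list \<tau> u"
      using w by (auto simp: orbit_def)
    have \<tau>': "inv \<tau> permutes {..<length u}" by (rule permutes_inv[OF \<tau>(1)])
    have "bij_betw (\<lambda>\<gamma>. \<gamma> \<circ> \<tau>) (stabilizer u) {\<sigma> \<in> ?P. permute_list \<sigma> u = w}"
    proof (rule bij_betw_byWitness[where f' = "\<lambda>\<sigma>. \<sigma> \<circ> inv \<tau>"])
      show "\<forall>\<gamma>\<in>stabilizer u. \<gamma> \<circ> \<tau> \<circ> inv \<tau> = \<gamma>"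
        using permutes_inv_o(1)[OF \<tau>(1)] by (simp add: o_assoc[symmetric])
      show "\<forall>\<sigma>\<in>{\<sigma> \<in> ?P. permute_list \<sigma> u = w}. \<sigma> \<circ> inv \<tau> \<circ> \<tau> = \<sigma>"
        using permutes_inv_o(2)[OF \<tau>(1)] by (simp add: o_assoc[symmetric])
      show "(\<lambda>\<gamma>. \<gamma> \<circ> \<tau>) ` stabilizer u \<subseteq> {\<sigma> \<in> ?P. permute_list \<sigma> u = w}"
        using \<tau> by (auto simp: stabilizer_def permute_list_compose permutes_compose)
      have "permute_list (inv \<tau>) w = u"
        using permute_list_compose[OF \<tau>', of \<tau>] permutes_inv_o(1)[OF \<tau>(1)] \<tau>(2) by simp
      then show "(\<lambda>\<sigma>. \<sigma> \<circ> inv \<tau>) ` {\<sigma> \<in> ?P. permute_list \<sigma> u = w} \<subseteq> stabilizer u"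
        using \<tau>' by (auto simp: stabilizer_def permute_list_compose permutes_compose)
    qed
    from bij_betw_same_card[OF this] show ?thesis by simp
  qed
  have "fact (length u) = card ?P" by (simp add: card_permutations)
  also have "\<dots> = (\<Sum>\<sigma>\<in>?P. 1)" by simp
  also have "\<dots> = (\<Sum>w\<in>orbit u. \<Sum>\<sigma>\<in>{\<sigma> \<in> ?P. permute_list \<sigma> u = w}. 1)"
    unfolding orbit_def by (rule sum.image_gen[OF fin])
  also have "\<dots> = (\<Sum>w\<in>orbit u. card (stabilizer u))" using fibre by simp
  finally show ?thesis by simp
qed

lemma orbit_eq_if_meet:
  assumes "w \<in> orbit u" "w \<in> orbit u'"
  shows "u' \<in> orbit u"
proof -
  obtain \<sigma> where \<sigma>: "\<sigma> permutes {..<length u}" "w = permute_list \<sigma> u"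
    using assms(1) by (auto simp: orbit_def)
  obtain \<tau> where \<tau>: "\<tau> permutes {..<length u'}" "w = permute_list \<tau> u'"
    using assms(2) by (auto simp: orbit_def)
  have len: "length u' = length u" using \<sigma>(2) \<tau>(2) by (metis length_permute_list)
  have \<tau>': "inv \<tau> permutes {..<length u'}" by (rule permutes_inv[OF \<tau>(1)])
  have "permute_list (\<sigma> \<circ> inv \<tau>) u = permute_list (inv \<tau>) w"
    using \<tau>' len \<sigma>(2) by (simp add: permute_list_compose)
  also have "\<dots> = u'"
    using permute_list_compose[OF \<tau>', of \<tau>] permutes_inv_o(1)[OF \<tau>(1)] \<tau>(2) by simp
  finally show ?thesis
    using permutes_compose[OF \<tau>'[unfolded len] \<sigma>(1)] by (auto simp: orbit_def)
qed

lemma orbit_refl: "u \<in> orbit u"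
  unfolding orbit_def using permutes_id by (intro image_eqI[of _ _ id]) auto

lemma summable_and_bounded_by_finite_sums:
  fixes f :: "'a \<Rightarrow> real"
  assumes "\<And>x. x \<in> X \<Longrightarrow> 0 \<le> f x" "\<And>F. finite F \<Longrightarrow> F \<subseteq> X \<Longrightarrow> sum f F \<le> b"
  shows "f summable_on X \<and> infsum f X \<le> b"
proof -
  have "f summable_on X"
    using assms by (intro nonneg_bdd_above_summable_on) (auto intro!: bdd_aboveI[of _ b])
  with assms(2) show ?thesis by (auto intro: infsum_le_finite_sums)
qed

section \<open>Coefficient functionals on monomials\<close>

context homogeneous_basis
begin

abbreviation "\<Phi> \<equiv> sym_functional smul V0 V1 \<phi>"

text \<open>
  On symmetric tensors the symmetrizer in the coefficient functional is absorbed by idempotence.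
\<close>

lemma sym_functional_eq: "v \<in> \<A> \<Longrightarrow> \<Phi> u v = tensor_functional \<phi> u (v (length u))"
  by (simp add: sym_functional_def sym_algebra_def symmetrizer_sym_power)

lemma monomial_component:
  "monomial u n = (if n = length u then \<S> n (tens smul (map e u)) else 0)"
  by (simp add: sym_monomial_def)

lemma sym_functional_add: "\<Phi> u (x + y) = \<Phi> u x + \<Phi> u y"
  unfolding sym_functional_def by (simp only: plus_fun_apply symmetrizer_add tensor_functional_add)

lemma sym_functional_scale: "\<Phi> u (sscale c x) = c * \<Phi> u x"
  unfolding sym_functional_def by (simp only: sscale_def symmetrizer_scale tensor_functional_scale)

lemma monomial_permute:
  assumes u: "u \<in> lists I" and \<sigma>: "\<sigma> permutes {..<length u}"
  shows "monomial (permute_list \<sigma> u) = sscale (koszul_sign V1 \<sigma> (map e u)) (monomial u)"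
proof (rule ext)
  fix n
  have "map e (permute_list \<sigma> u) = permute_list \<sigma> (map e u)"
    using \<sigma> by (simp add: permute_list_map)
  moreover have "\<S> (length u) (tens smul (permute_list \<sigma> (map e u))) =
      tscale (koszul_sign V1 \<sigma> (map e u)) (\<S> (length u) (tens smul (map e u)))"
    using \<sigma> by (intro symmetrizer_permute[OF homogeneous_word[OF u]]) auto
  ultimately show "monomial (permute_list \<sigma> u) n = sscale (koszul_sign V1 \<sigma> (map e u)) (monomial u) n"
    by (auto simp: monomial_component sscale_def)
qed

lemma word_functional_delta:
  assumes "length u = length w" "u \<in> lists I" "w \<in> lists I"
  shows "prod_list (map2 \<phi> u (map e w)) = (if w = u then 1 else 0)"
  using assms by (induction u w rule: list_induct2) (auto simp: functional_e)

text \<open>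
  Only the permutations that turn the word \<open>w\<close> into \<open>u\<close> survive, by biorthogonality of the letters.
\<close>

lemma sym_functional_monomial:
  assumes u: "u \<in> lists I" "length u = n" and w: "w \<in> lists I" "length w = n"
  shows "\<Phi> u (monomial w) =
    (\<Sum>\<sigma> | \<sigma> permutes {..<n} \<and> permute_list \<sigma> w = u. koszul_sign V1 \<sigma> (map e w)) / fact n"
proof -
  have "\<Phi> u (monomial w) = tensor_functional \<phi> u (\<S> n (tens smul (map e w)))"
    using u w by (simp add: sym_functional_eq[OF sym_monomial_in_sym_algebra] monomial_component)
  also have "\<dots> = (1 / fact n) * (\<Sum>\<sigma> | \<sigma> permutes {..<n}.
      koszul_sign V1 \<sigma> (map e w) * tensor_functional \<phi> u (tens smul (permute_list \<sigma> (map e w))))"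
    using homogeneous_word[OF w(1)] w(2)
    by (simp only: symmetrizer_tens length_map tensor_functional_scale tensor_functional_sum)
  also have "(\<Sum>\<sigma> | \<sigma> permutes {..<n}.
      koszul_sign V1 \<sigma> (map e w) * tensor_functional \<phi> u (tens smul (permute_list \<sigma> (map e w)))) =
      (\<Sum>\<sigma> | \<sigma> permutes {..<n}. if permute_list \<sigma> w = u then koszul_sign V1 \<sigma> (map e w) else 0)"
  proof (rule sum.cong[OF refl])
    fix \<sigma> assume "\<sigma> \<in> {\<sigma>. \<sigma> permutes {..<n}}"
    then have \<sigma>: "\<sigma> permutes {..<length w}" by (simp add: w)
    then have "tensor_functional \<phi> u (tens smul (permute_list \<sigma> (map e w))) =
        prod_list (map2 \<phi> u (map e (permute_list \<sigma> w)))"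
      using u w functional by (subst tensor_functional_tens) (auto simp: permute_list_map)
    also have "\<dots> = (if permute_list \<sigma> w = u then 1 else 0)"
      using \<sigma> u w by (intro word_functional_delta) auto
    finally show "koszul_sign V1 \<sigma> (map e w) * tensor_functional \<phi> u (tens smul (permute_list \<sigma> (map e w))) =
        (if permute_list \<sigma> w = u then koszul_sign V1 \<sigma> (map e w) else 0)" by simp
  qed
  also have "\<dots> = (\<Sum>\<sigma> | \<sigma> permutes {..<n} \<and> permute_list \<sigma> w = u. koszul_sign V1 \<sigma> (map e w))"
    by (subst sum.inter_filter[symmetric]) (simp_all add: finite_permutations)
  finally show ?thesis by simp
qed

lemma sym_functional_monomial_length:
  assumes "length w \<noteq> length u"
  shows "\<Phi> u (monomial w) = 0"
  using assms
  by (simp add: sym_functional_eq[OF sym_monomial_in_sym_algebra] monomial_component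
      tensor_functional_zero)

lemma sym_functional_permute_monomial:
  assumes u: "u \<in> lists I" and z: "z \<in> lists I" and \<sigma>: "\<sigma> permutes {..<length u}"
  shows "\<Phi> (permute_list \<sigma> u) (monomial z) = koszul_sign V1 \<sigma> (map e u) * \<Phi> u (monomial z)"
proof (cases "length z = length u")
  case False
  then show ?thesis by (simp add: sym_functional_monomial_length)
next
  case True
  let ?n = "length u" and ?k = "\<lambda>\<tau>. koszul_sign V1 \<tau> (map e z) :: 'k"
  have \<sigma>': "inv \<sigma> permutes {..<?n}" by (rule permutes_inv[OF \<sigma>])
  have "(\<Sum>\<tau> | \<tau> permutes {..<?n} \<and> permute_list \<tau> z = permute_list \<sigma> u. ?k \<tau>) =
      (\<Sum>\<tau> | \<tau> permutes {..<?n} \<and> permute_list \<tau> z = u. koszul_sign V1 \<sigma> (map e u) * ?k \<tau>)"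
  proof (rule sum.reindex_bij_witness[where i = "\<lambda>\<tau>. \<tau> \<circ> \<sigma>" and j = "\<lambda>\<tau>. \<tau> \<circ> inv \<sigma>"])
    fix \<tau> assume "\<tau> \<in> {\<tau>. \<tau> permutes {..<?n} \<and> permute_list \<tau> z = permute_list \<sigma> u}"
    then have \<tau>: "\<tau> permutes {..<?n}" "permute_list \<tau> z = permute_list \<sigma> u" by auto
    show eq: "\<tau> \<circ> inv \<sigma> \<circ> \<sigma> = \<tau>"
      using permutes_inv_o(2)[OF \<sigma>] by (simp add: o_assoc[symmetric])
    have inv: "permute_list (\<tau> \<circ> inv \<sigma>) z = u"
      using permute_list_compose[of "inv \<sigma>" z \<tau>] permute_list_compose[OF \<sigma>', of \<sigma>]
        \<sigma>' permutes_inv_o(1)[OF \<sigma>] True \<tau>(2) by simp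
    then show "\<tau> \<circ> inv \<sigma> \<in> {\<tau>. \<tau> permutes {..<?n} \<and> permute_list \<tau> z = u}"
      using permutes_compose[OF \<sigma>' \<tau>(1)] by simp
    have "?k (\<tau> \<circ> inv \<sigma> \<circ> \<sigma>) =
        ?k (\<tau> \<circ> inv \<sigma>) * koszul_sign V1 \<sigma> (permute_list (\<tau> \<circ> inv \<sigma>) (map e z))"
      using \<sigma> True permutes_compose[OF \<sigma>' \<tau>(1)] by (intro koszul_sign_compose) auto
    also have "permute_list (\<tau> \<circ> inv \<sigma>) (map e z) = map e u"
      using permutes_compose[OF \<sigma>' \<tau>(1)] True inv by (simp add: permute_list_map)
    finally show "koszul_sign V1 \<sigma> (map e u) * ?k (\<tau> \<circ> inv \<sigma>) = ?k \<tau>"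
      by (simp only: eq mult.commute)
  next
    fix \<tau> assume "\<tau> \<in> {\<tau>. \<tau> permutes {..<?n} \<and> permute_list \<tau> z = u}"
    then have \<tau>: "\<tau> permutes {..<?n}" "permute_list \<tau> z = u" by auto
    show "\<tau> \<circ> \<sigma> \<circ> inv \<sigma> = \<tau>"
      using permutes_inv_o(1)[OF \<sigma>] by (simp add: o_assoc[symmetric])
    show "\<tau> \<circ> \<sigma> \<in> {\<tau>. \<tau> permutes {..<?n} \<and> permute_list \<tau> z = permute_list \<sigma> u}"
      using permutes_compose[OF \<sigma> \<tau>(1)] \<sigma> \<tau>(2) True by (simp add: permute_list_compose)
  qed
  moreover have "permute_list \<sigma> u \<in> lists I" "length (permute_list \<sigma> u) = ?n"
    using orbit_subset_lists[OF u] \<sigma> by (auto simp: orbit_def)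
  ultimately show ?thesis
    by (simp add: sym_functional_monomial[OF _ _ z True] u sum_distrib_left[symmetric] del: in_lists_conv_set)
qed

section \<open>Estimates for the coefficient functionals\<close>

lemma weighted_monomial:
  assumes p: "seminorm p"
  shows "\<rho> p r (monomial u) =
    \<pi> (length u) p (\<S> (length u) (tens smul (map e u))) * fact (length u) powr r"
  by (subst weighted_seminorm_superset[OF p, of "{length u}"]) (auto simp: monomial_component)

lemma weighted_monomial_orbit:
  assumes p: "seminorm p" and u: "u \<in> lists I" and w: "w \<in> orbit u"
  shows "\<rho> p r (monomial w) = \<rho> p r (monomial u)"
proof -
  obtain \<sigma> where \<sigma>: "\<sigma> permutes {..<length u}" "w = permute_list \<sigma> u"
    using w by (auto simp: orbit_def)
  have "norm (koszul_sign V1 \<sigma> (map e u) :: 'k) = 1"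
    using koszul_sign_cases[of V1 \<sigma> "map e u", where 'k = 'k] by auto
  then show ?thesis
    unfolding \<sigma>(2) monomial_permute[OF u \<sigma>(1)]
      weighted_seminorm_scale[OF p sym_monomial_in_sym_algebra] by simp
qed

lemma degree_estimate:
  assumes p: "seminorm p" and q: "seminorm q" and est: "absolute_estimate UNIV I e \<phi> p q"
    and v: "v \<in> \<A>" and F: "finite F" "F \<subseteq> {u \<in> lists I. length u = n}"
  shows "(\<Sum>u\<in>F. norm (\<Phi> u v) * \<rho> p r (monomial u)) \<le> \<pi> n q (v n) * fact n powr r"
proof -
  have "(\<Sum>u\<in>F. norm (\<Phi> u v) * \<rho> p r (monomial u)) \<le>
      (\<Sum>u\<in>F. norm (tensor_functional \<phi> u (v n)) * prod_list (map (\<lambda>i. p (e i)) u) * fact n powr r)"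
  proof (rule sum_mono)
    fix u assume "u \<in> F"
    then have u: "u \<in> lists I" "length u = n" using F by auto
    have "\<rho> p r (monomial u) \<le> prod_list (map p (map e u)) * fact n powr r"
      using tensor_seminorm_symmetrizer[OF p homogeneous_word[OF u(1)], of n] u(2)
      by (simp add: weighted_monomial[OF p] mult_right_mono)
    then have "norm (\<Phi> u v) * \<rho> p r (monomial u) \<le>
        norm (\<Phi> u v) * (prod_list (map p (map e u)) * fact n powr r)"
      by (rule mult_left_mono) simp
    then show "norm (\<Phi> u v) * \<rho> p r (monomial u) \<le>
        norm (tensor_functional \<phi> u (v n)) * prod_list (map (\<lambda>i. p (e i)) u) * fact n powr r"
      using sym_functional_eq[OF v, of u] u(2) by (simp add: o_def mult.assoc)
  qed
  also have "\<dots> = (\<Sum>u\<in>F. norm (tensor_functional \<phi> u (v n)) * prod_list (map (\<lambda>i. p (e i)) u)) *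
      fact n powr r"
    by (simp add: sum_distrib_right)
  also have "\<dots> \<le> \<pi> n q (v n) * fact n powr r"
    using word_estimate[OF p q functional est sym_algebra_component[OF v] F]
    by (intro mult_right_mono) auto
  finally show ?thesis .
qed

lemma sym_functional_zero_component: "v \<in> \<A> \<Longrightarrow> v (length u) = 0 \<Longrightarrow> \<Phi> u v = 0"
  by (simp add: sym_functional_eq tensor_functional_zero)

lemma all_words_estimate:
  assumes p: "seminorm p" and q: "seminorm q" and est: "absolute_estimate UNIV I e \<phi> p q"
    and v: "v \<in> \<A>" and F: "finite F" "F \<subseteq> lists I"
  shows "(\<Sum>u\<in>F. norm (\<Phi> u v) * \<rho> p r (monomial u)) \<le> \<rho> q r v"
proof -
  let ?N = "{n. v n \<noteq> 0}" and ?a = "\<lambda>u. norm (\<Phi> u v) * \<rho> p r (monomial u)"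
  let ?F = "{u \<in> F. length u \<in> ?N}"
  have "sum ?a F = sum ?a ?F"
    using F(1) sym_functional_zero_component[OF v] by (intro sum.mono_neutral_right) auto
  also have "\<dots> = (\<Sum>n\<in>?N. sum ?a {u \<in> ?F. length u = n})"
    using F(1) sym_algebra_finite[OF v] by (intro sum.group[symmetric]) auto
  also have "\<dots> \<le> (\<Sum>n\<in>?N. \<pi> n q (v n) * fact n powr r)"
    using F by (intro sum_mono degree_estimate[OF p q est v]) auto
  finally show ?thesis by (simp add: weighted_seminorm_def)
qed

text \<open>
  The seminorm \<open>\<Sum>\<^sub>i |\<phi> i|\<close> over the letters of \<open>u\<close> takes the value \<open>1\<close> at each basis vector
  that occurs in \<open>u\<close>.  In the word estimate for it the weight of every rearrangement of \<open>u\<close> is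
  \<open>1\<close>, so one seminorm bounds the functionals of the whole orbit.
\<close>

lemma sym_functional_bounded:
  assumes u: "u \<in> lists I"
  shows "\<exists>q. seminorm q \<and> (\<forall>w r v. w \<in> orbit u \<longrightarrow> v \<in> \<A> \<longrightarrow>
    norm (\<Phi> w v) \<le> 1 / fact (length u) powr r * \<rho> q r v)"
proof -
  let ?p = "\<lambda>x. \<Sum>i\<in>set u. norm (\<phi> i x)"
  have p: "seminorm ?p" using u functional by (intro seminorm_sum_functionals) auto
  obtain q where q: "seminorm q" "absolute_estimate UNIV I e \<phi> ?p q"
    using basis p by (auto simp: absolute_schauder_basis_def topspace_UNIV)
  have pe: "?p (e i) = 1" if "i \<in> set u" for i
  proof -
    have "?p (e i) = (\<Sum>j\<in>set u. if j = i then 1 else 0)"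
      using that u by (intro sum.cong) (auto simp: functional_e)
    then show ?thesis using that by simp
  qed
  have "norm (\<Phi> w v) \<le> 1 / fact (length u) powr r * \<rho> q r v"
    if w: "w \<in> orbit u" and v: "v \<in> \<A>" for w r v
  proof -
    let ?n = "length u"
    have wI: "w \<in> lists I" "length w = ?n" "set w \<subseteq> set u"
      using w u by (auto simp: orbit_def)
    have "map (\<lambda>i. ?p (e i)) w = map (\<lambda>_. 1) w" using pe wI(3) by (intro map_cong) auto
    then have "prod_list (map (\<lambda>i. ?p (e i)) w) = 1" by (simp add: map_replicate_const)
    then have "norm (\<Phi> w v) \<le> \<pi> ?n q (v ?n)"
      using word_estimate[OF p q(1) functional q(2) sym_algebra_component[OF v], of "{w}" ?n]
        wI sym_functional_eq[OF v, of w] by simp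
    then have "norm (\<Phi> w v) * fact ?n powr r \<le> \<pi> ?n q (v ?n) * fact ?n powr r"
      by (rule mult_right_mono) simp
    also have "\<dots> \<le> \<rho> q r v"
    proof (cases "v ?n = 0")
      case True
      then show ?thesis using weighted_seminorm_nonneg[OF q(1) v] tensor_seminorm_zero[OF q(1)] by simp
    next
      case False
      then show ?thesis
        unfolding weighted_seminorm_def
        using sym_algebra_finite[OF v] tensor_seminorm_nonneg[OF q(1) sym_algebra_component[OF v]]
        by (intro member_le_sum[of ?n]) auto
    qed
    finally show ?thesis by (simp add: field_simps)
  qed
  with q(1) show ?thesis by blast
qed

text \<open>
  Both sides are bounded by a common weighted seminorm and agree on the monomials, which are dense.
\<close>

lemma sym_functional_permute:
  assumes u: "u \<in> lists I" and \<sigma>: "\<sigma> permutes {..<length u}" and v: "v \<in> \<A>"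
  shows "\<Phi> (permute_list \<sigma> u) v = koszul_sign V1 \<sigma> (map e u) * \<Phi> u v"
proof (rule ccontr)
  let ?k = "koszul_sign V1 \<sigma> (map e u) :: 'k" and ?w = "permute_list \<sigma> u"
  \<comment> \<open>The exponent \<open>0\<close> below is arbitrary: the functional sees a single degree.\<close>
  define D where "D x = \<Phi> ?w x - ?k * \<Phi> u x" for x
  assume "\<Phi> ?w v \<noteq> ?k * \<Phi> u v"
  then have Dv: "0 < norm (D v)" by (simp add: D_def)
  obtain q where q: "seminorm q" and bound: "\<And>w x. w \<in> orbit u \<Longrightarrow> x \<in> \<A> \<Longrightarrow>
      norm (\<Phi> w x) \<le> 1 / fact (length u) powr 0 * \<rho> q 0 x"
    using sym_functional_bounded[OF u] by blast
  obtain w where w: "w \<in> tensors.span (monomial ` lists I)" "\<rho> q 0 (v - w) < norm (D v) / 2"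
    using monomials_dense[OF q v, of "norm (D v) / 2"] Dv by auto
  have D_add: "D (x + y) = D x + D y" for x y
    by (simp add: D_def sym_functional_add algebra_simps)
  have D_scale: "D (sscale c x) = c * D x" for c x
    by (simp add: D_def sym_functional_scale algebra_simps)
  have "D w = 0"
    using w(1)
  proof (induction rule: tensors.span_induct_alt)
    case base
    show ?case using D_scale[of 0 0] by (simp only: tensors.scale_zero_left mult_zero_left)
  next
    case (step c x y)
    then have "D x = 0" using sym_functional_permute_monomial[OF u _ \<sigma>] by (auto simp: D_def)
    with step show ?case by (simp only: D_add D_scale mult_zero_right add_0_left)
  qed
  have wA: "w \<in> \<A>"
    using w(1) tensors.span_minimal[OF _ subspace_sym_algebra, of "monomial ` lists I"]
      sym_monomial_in_sym_algebra by blast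
  have vw: "v - w \<in> \<A>" by (rule tensors.subspace_diff[OF subspace_sym_algebra v wA])
  have "D v = D (v - w)" using D_add[of "v - w" w] \<open>D w = 0\<close> by simp
  also have "norm \<dots> \<le> norm (\<Phi> ?w (v - w)) + norm (?k * \<Phi> u (v - w))"
    unfolding D_def by (rule norm_triangle_ineq4)
  also have "norm (?k * \<Phi> u (v - w)) = norm (\<Phi> u (v - w))"
    using koszul_sign_cases[of V1 \<sigma> "map e u", where 'k = 'k] by auto
  also have "norm (\<Phi> ?w (v - w)) + norm (\<Phi> u (v - w)) \<le> 2 * \<rho> q 0 (v - w)"
  proof -
    have "?w \<in> orbit u" using \<sigma> by (auto simp: orbit_def)
    from bound[OF this vw] bound[OF orbit_refl vw] show ?thesis by simp
  qed
  finally show False using w(2) by simp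
qed

section \<open>Normalised coefficient functionals\<close>

text \<open>
  A rearrangement that fixes the word but has sign \<open>-1\<close>, such as the exchange of two equal odd
  letters, forces the monomial to be its own negative.
\<close>

lemma stabilizer_sign:
  assumes u: "u \<in> lists I" "monomial u \<noteq> 0" and \<sigma>: "\<sigma> \<in> stabilizer u"
  shows "koszul_sign V1 \<sigma> (map e u) = (1 :: 'k)"
proof (rule ccontr)
  assume "koszul_sign V1 \<sigma> (map e u) \<noteq> (1 :: 'k)"
  then have "koszul_sign V1 \<sigma> (map e u) = (- 1 :: 'k)"
    using koszul_sign_cases[of V1 \<sigma> "map e u", where 'k = 'k] by auto
  then have "monomial u = sscale (- 1) (monomial u)"
    using monomial_permute[OF u(1), of \<sigma>] \<sigma> by (simp add: stabilizer_def)
  moreover have "sscale 2 (monomial u) = monomial u - sscale (- 1) (monomial u)"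
    using tensors.scale_left_distrib[of 1 1 "monomial u"] by simp
  ultimately have "sscale 2 (monomial u) = 0" by simp
  then show False using u(2) tensors.scale_eq_0_iff[of 2 "monomial u"] by simp
qed

text \<open>
  All terms of the sum over the stabilizer are \<open>1\<close>, so the value is the order of the stabilizer
  divided by \<open>n!\<close>, and the orbit-stabilizer formula makes this the inverse of the size of the orbit.
\<close>

lemma sym_functional_self:
  assumes u: "u \<in> lists I" "monomial u \<noteq> 0"
  shows "\<Phi> u (monomial u) = 1 / of_nat (card (orbit u))"
proof -
  have "\<Phi> u (monomial u) = (\<Sum>\<sigma>\<in>stabilizer u. koszul_sign V1 \<sigma> (map e u)) / fact (length u)"
    using sym_functional_monomial[OF u(1) refl u(1) refl] by (simp add: stabilizer_def)
  also have "(\<Sum>\<sigma>\<in>stabilizer u. koszul_sign V1 \<sigma> (map e u)) = (of_nat (card (stabilizer u)) :: 'k)"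
    using stabilizer_sign[OF u] by simp
  finally have *: "\<Phi> u (monomial u) = of_nat (card (stabilizer u)) / fact (length u)" .
  have "card (stabilizer u) \<noteq> 0"
  proof
    assume "card (stabilizer u) = 0"
    then show False using card_orbit_stabilizer[of u] by simp
  qed
  moreover have "(fact (length u) :: 'k) = of_nat (card (orbit u)) * of_nat (card (stabilizer u))"
    by (simp only: of_nat_mult[symmetric] card_orbit_stabilizer of_nat_fact)
  ultimately show ?thesis unfolding * by simp
qed

text \<open>
  The normalising factor is the number of rearrangements of \<open>u\<close>, and each of them has a coefficient of
  the same absolute value.  This is why a family with one word from each orbit satisfies the same
  estimate as the family of all words: no constant is lost by dividing by small values.
\<close>

lemma normalised_functional_norm:
  assumes u: "u \<in> lists I" "monomial u \<noteq> 0" and v: "v \<in> \<A>"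
  shows "norm (\<Phi> u v / \<Phi> u (monomial u)) = (\<Sum>w\<in>orbit u. norm (\<Phi> w v))"
proof -
  have "norm (\<Phi> w v) = norm (\<Phi> u v)" if w: "w \<in> orbit u" for w
  proof -
    obtain \<sigma> where \<sigma>: "\<sigma> permutes {..<length u}" "w = permute_list \<sigma> u"
      using w by (auto simp: orbit_def)
    then show ?thesis
      using sym_functional_permute[OF u(1) \<sigma>(1) v]
        koszul_sign_cases[of V1 \<sigma> "map e u", where 'k = 'k] by auto
  qed
  then have "(\<Sum>w\<in>orbit u. norm (\<Phi> w v)) = card (orbit u) * norm (\<Phi> u v)" by simp
  then show ?thesis by (simp add: sym_functional_self[OF u] norm_mult)
qed

end

text \<open>
  A maximal linearly independent set of monomials enters the argument through the fact that it
  spans all monomials.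
\<close>

locale monomial_basis = homogeneous_basis +
  fixes J
  assumes J: "J \<subseteq> lists I"
    and inj: "inj_on monomial J"
    and independent_J: "tensors.independent (monomial ` J)"
    and spanning: "monomial ` lists I \<subseteq> tensors.span (monomial ` J)"
begin

abbreviation "\<psi> u v \<equiv> \<Phi> u v / \<Phi> u (monomial u)"

lemma monomial_nonzero: "u \<in> J \<Longrightarrow> monomial u \<noteq> 0"
  using independent_J tensors.dependent_zero[of "monomial ` J"] by fastforce

text \<open>
  Monomials of rearranged words agree up to a sign: they are equal or linearly dependent.
\<close>

lemma orbit_meets_J_once:
  assumes u: "u \<in> J" and w: "w \<in> J" "w \<in> orbit u"
  shows "w = u"
proof (rule ccontr)
  assume "w \<noteq> u"
  then have ne: "monomial u \<noteq> monomial w" using inj u w(1) by (auto dest: inj_onD)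
  obtain \<sigma> where \<sigma>: "\<sigma> permutes {..<length u}" "w = permute_list \<sigma> u"
    using w by (auto simp: orbit_def)
  have "monomial w = sscale (koszul_sign V1 \<sigma> (map e u)) (monomial u)"
    unfolding \<sigma>(2) using J u \<sigma>(1) by (intro monomial_permute) auto
  moreover have "monomial u \<in> monomial ` J - {monomial w}" using ne u by simp
  ultimately have "monomial w \<in> tensors.span (monomial ` J - {monomial w})"
    by (simp only: tensors.span_scale tensors.span_base)
  then show False using independent_J w(1) by (auto simp: tensors.dependent_def)
qed

lemma biorthogonal:
  assumes u: "u \<in> J" and w: "w \<in> J"
  shows "\<psi> u (monomial w) = (if u = w then 1 else 0)"
proof (cases "u = w")
  case True
  have "card (orbit u) \<noteq> 0" using orbit_refl[of u] finite_orbit[of u] by auto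
  moreover have "u \<in> lists I" using u J by blast
  ultimately have "\<Phi> u (monomial u) \<noteq> 0"
    by (simp only: sym_functional_self[OF _ monomial_nonzero[OF u]]) simp
  with True show ?thesis by simp
next
  case False
  have "\<Phi> u (monomial w) = 0"
  proof (cases "length w = length u")
    case len: True
    have empty: "{\<sigma>. \<sigma> permutes {..<length u} \<and> permute_list \<sigma> w = u} = {}"
    proof (rule ccontr)
      assume "{\<sigma>. \<sigma> permutes {..<length u} \<and> permute_list \<sigma> w = u} \<noteq> {}"
      then have "u \<in> orbit w" using len by (auto simp: orbit_def)
      then show False using orbit_meets_J_once[OF w u] False by simp
    qed
    have "u \<in> lists I" "w \<in> lists I" using u w J by blast+
    from sym_functional_monomial[OF this(1) refl this(2) len] show ?thesis
      by (simp only: empty sum.empty div_0)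
  qed (rule sym_functional_monomial_length)
  with False show ?thesis by simp
qed

text \<open>
  The orbits of distinct words in \<open>J\<close> are disjoint, so that the sum over \<open>J\<close> becomes a sum over
  words, each counted at most once.
\<close>

lemma absolute_estimate_monomials:
  assumes p: "seminorm p" and q: "seminorm q" and est: "absolute_estimate UNIV I e \<phi> p q"
  shows "absolute_estimate \<A> J monomial \<psi> (\<rho> p r) (\<rho> q r)"
  unfolding absolute_estimate_def
proof
  fix v assume v: "v \<in> \<A>"
  let ?a = "\<lambda>w. norm (\<Phi> w v) * \<rho> p r (monomial w)"
  have "(\<Sum>u\<in>F. norm (\<psi> u v) * \<rho> p r (monomial u)) \<le> \<rho> q r v" if F: "finite F" "F \<subseteq> J" for F
  proof -
    have "norm (\<psi> u v) * \<rho> p r (monomial u) = sum ?a (orbit u)" if "u \<in> F" for u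
    proof -
      have u: "u \<in> lists I" "monomial u \<noteq> 0" using that F J monomial_nonzero by auto
      show ?thesis
        unfolding normalised_functional_norm[OF u v] sum_distrib_right
        using weighted_monomial_orbit[OF p u(1)] by (intro sum.cong) auto
    qed
    then have "(\<Sum>u\<in>F. norm (\<psi> u v) * \<rho> p r (monomial u)) = (\<Sum>u\<in>F. sum ?a (orbit u))"
      by (intro sum.cong) auto
    also have "\<dots> = sum ?a (\<Union>u\<in>F. orbit u)"
    proof (rule sum.UNION_disjoint[symmetric])
      show "\<forall>u\<in>F. \<forall>w\<in>F. u \<noteq> w \<longrightarrow> orbit u \<inter> orbit w = {}"
      proof (intro ballI impI equals0I)
        fix u w x assume *: "u \<in> F" "w \<in> F" "u \<noteq> w" "x \<in> orbit u \<inter> orbit w"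
        then have "w \<in> orbit u" using orbit_eq_if_meet[of x u w] by simp
        with * show False using orbit_meets_J_once[of u w] F(2) by auto
      qed
    qed (use F finite_orbit in auto)
    also have "\<dots> \<le> \<rho> q r v"
    proof (rule all_words_estimate[OF p q est v])
      show "finite (\<Union>u\<in>F. orbit u)" using F finite_orbit by auto
      show "(\<Union>u\<in>F. orbit u) \<subseteq> lists I"
      proof (rule UN_least)
        fix u assume "u \<in> F"
        then have "u \<in> lists I" using F(2) J by blast
        then show "orbit u \<subseteq> lists I" by (rule orbit_subset_lists)
      qed
    qed
    finally show ?thesis .
  qed
  then show "(\<lambda>u. norm (\<psi> u v) * \<rho> p r (monomial u)) summable_on J \<and>
      (\<Sum>\<^sub>\<infinity>u\<in>J. norm (\<psi> u v) * \<rho> p r (monomial u)) \<le> \<rho> q r v"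
    by (intro summable_and_bounded_by_finite_sums mult_nonneg_nonneg norm_ge_zero
        weighted_seminorm_nonneg[OF p] sym_monomial_in_sym_algebra)
qed

lemma absolute_schauder_basis_monomials:
  assumes S: "S \<noteq> {}"
  shows "absolute_schauder_basis sscale (seminorm_topology \<A> (weighted_family S)) J monomial \<psi>"
proof -
  interpret D: directed_seminorms sscale \<A> "weighted_family S"
    by (rule directed_weighted_family[OF S])
  show ?thesis
  proof (rule D.absolute_schauder_basis_if_dense)
    show "monomial ` J \<subseteq> \<A>" using sym_monomial_in_sym_algebra by blast
    show "inj_on monomial J" by (rule inj)
    show "tensors.independent (monomial ` J)" by (rule independent_J)
    show "\<psi> u (x + y) = \<psi> u x + \<psi> u y" for u x y
      by (simp add: sym_functional_add add_divide_distrib)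
    show "\<psi> u (sscale c x) = c * \<psi> u x" for u c x
      by (simp add: sym_functional_scale)
    show "\<psi> u (monomial w) = (if u = w then 1 else 0)" if "u \<in> J" "w \<in> J" for u w
      using that by (rule biorthogonal)
  next
    fix u assume u: "u \<in> J"
    obtain r where r: "r \<in> S" using S by blast
    have "u \<in> lists I" using u J by auto
    then obtain q where q: "seminorm q" "\<And>v. v \<in> \<A> \<Longrightarrow>
        norm (\<Phi> u v) \<le> 1 / fact (length u) powr r * \<rho> q r v"
      using sym_functional_bounded[of u] orbit_refl[of u] by blast
    let ?c = "norm (\<Phi> u (monomial u))" 
    have "norm (\<psi> u v) \<le> (1 / fact (length u) powr r / ?c) * \<rho> q r v" if "v \<in> \<A>" for v
      using divide_right_mono[OF q(2)[OF that], of ?c] by (simp add: norm_divide)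
    moreover have "\<rho> q r \<in> weighted_family S" using q(1) r by (auto simp: weighted_family_def)
    ultimately show "\<exists>P\<in>weighted_family S. \<exists>C. \<forall>v\<in>\<A>. norm (\<psi> u v) \<le> C * P v" by blast
  next
    fix P v and \<epsilon> :: real assume P: "P \<in> weighted_family S" and v: "v \<in> \<A>" and \<epsilon>: "0 < \<epsilon>"
    obtain p r where "P = \<rho> p r" "seminorm p" using P by (auto simp: weighted_family_def)
    moreover have "tensors.span (monomial ` lists I) \<subseteq> tensors.span (monomial ` J)"
      using spanning by (rule tensors.span_minimal) (rule tensors.subspace_span)
    ultimately show "\<exists>w\<in>tensors.span (monomial ` J). P (v - w) < \<epsilon>"
      using monomials_dense[of p v \<epsilon> r] v \<epsilon> by blast
  next
    fix P assume "P \<in> weighted_family S"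
    then obtain p r where P: "P = \<rho> p r" "seminorm p" "r \<in> S" by (auto simp: weighted_family_def)
    obtain q where q: "seminorm q" "absolute_estimate UNIV I e \<phi> p q"
      using basis P(2) by (auto simp: absolute_schauder_basis_def topspace_UNIV)
    have "\<rho> q r \<in> weighted_family S" using q(1) P(3) by (auto simp: weighted_family_def)
    then show "\<exists>Q\<in>weighted_family S. absolute_estimate \<A> J monomial \<psi> P Q"
      using absolute_estimate_monomials[OF P(2) q] P(1) by blast
  qed
qed

end

lemma maximal_independent_spans:
  assumes max: "maximal_independent sscale M (B :: ('k::field, 'v) tensors set)"
  shows "M \<subseteq> tensors.span B"
proof
  fix x assume x: "x \<in> M"
  show "x \<in> tensors.span B"
  proof (rule ccontr)
    assume "x \<notin> tensors.span B"
    moreover from this have "tensors.independent (insert x B)"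
      using max by (simp add: maximal_independent_def tensors.independent_insert)
    then have "insert x B = B" using max x by (auto simp: maximal_independent_def)
    ultimately show False using tensors.span_base by blast
  qed
qed

context homogeneous_basis
begin

lemma degreewise_estimate:
  fixes R :: real
  assumes p: "seminorm p" and q: "seminorm q" and est: "absolute_estimate UNIV I e \<phi> p q"
    and v: "v \<in> \<A>"
  defines "a \<equiv> \<lambda>u. norm (\<Phi> u v) * \<rho> p R (monomial u)"
  shows "(\<forall>n. a summable_on {u \<in> lists I. length u = n}) \<and>
    summable (\<lambda>n. \<Sum>\<^sub>\<infinity>u\<in>{u \<in> lists I. length u = n}. a u) \<and>
    (\<Sum>n. \<Sum>\<^sub>\<infinity>u\<in>{u \<in> lists I. length u = n}. a u) \<le> \<rho> q R v"
proof -
  let ?L = "\<lambda>n. {u \<in> lists I. length u = n}" and ?N = "{n. v n \<noteq> 0}"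
  have a0: "0 \<le> a u" for u
    unfolding a_def
    by (intro mult_nonneg_nonneg norm_ge_zero weighted_seminorm_nonneg[OF p] sym_monomial_in_sym_algebra)
  have *: "a summable_on ?L n \<and> infsum a (?L n) \<le> \<pi> n q (v n) * fact n powr R" for n
    using a0 unfolding a_def
    by (intro summable_and_bounded_by_finite_sums degree_estimate[OF p q est v]) auto
  have zero: "infsum a (?L n) = 0" if "n \<notin> ?N" for n
    using that sym_functional_zero_component[OF v] by (intro infsum_0) (auto simp: a_def)
  have "summable (\<lambda>n. infsum a (?L n))"
    using sym_algebra_finite[OF v] zero by (rule summable_finite)
  moreover have "(\<Sum>n. infsum a (?L n)) = (\<Sum>n\<in>?N. infsum a (?L n))"
    using sym_algebra_finite[OF v] zero by (rule suminf_finite)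
  moreover have "\<dots> \<le> \<rho> q R v"
    unfolding weighted_seminorm_def using * by (intro sum_mono) auto
  ultimately show ?thesis using * by simp
qed

end

theorem proposition4p4:
  fixes smul :: "'k::real_normed_field \<Rightarrow> 'v::ab_group_add \<Rightarrow> 'v"
    and T :: "'v topology" and V0 V1 :: "'v set"
    and I :: "'i set" and e :: "'i \<Rightarrow> 'v" and \<phi> :: "'i \<Rightarrow> 'v \<Rightarrow> 'k"
    and R :: real
  assumes "graded_locally_convex_space smul T V0 V1"
    and "R \<ge> 0"
    and "absolute_schauder_basis smul T I e \<phi>"
    and "\<forall>i\<in>I. e i \<in> V0 \<union> V1"
  shows "(\<forall>J \<subseteq> lists I.
            inj_on (sym_monomial smul V0 V1 e) J \<and>
            maximal_independent sscale (sym_monomial smul V0 V1 e ` lists I)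
              (sym_monomial smul V0 V1 e ` J) \<longrightarrow>
            (let \<psi> = (\<lambda>u v. sym_functional smul V0 V1 \<phi> u v /
                             sym_functional smul V0 V1 \<phi> u (sym_monomial smul V0 V1 e u))
             in absolute_schauder_basis sscale (sym_topology smul T V0 V1 R)
                  J (sym_monomial smul V0 V1 e) \<psi> \<and>
                absolute_schauder_basis sscale (weyl_minus_topology smul T V0 V1 R)
                  J (sym_monomial smul V0 V1 e) \<psi>)) \<and>
         (\<forall>p q. continuous_seminorm smul T p \<and> continuous_seminorm smul T q \<and>
            absolute_estimate UNIV I e \<phi> p q \<longrightarrow>
            (\<forall>v\<in>sym_algebra smul V0 V1.
               let a = (\<lambda>u. norm (sym_functional smul V0 V1 \<phi> u v) *
                            weighted_seminorm smul p R (sym_monomial smul V0 V1 e u))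
               in (\<forall>n. a summable_on {u \<in> lists I. length u = n}) \<and>
                  summable (\<lambda>n. \<Sum>\<^sub>\<infinity>u\<in>{u \<in> lists I. length u = n}. a u) \<and>
                  (\<Sum>n. \<Sum>\<^sub>\<infinity>u\<in>{u \<in> lists I. length u = n}. a u)
                    \<le> weighted_seminorm smul q R v))"
proof -
  interpret homogeneous_basis smul T V0 V1 I e \<phi>
    using assms by (simp add: homogeneous_basis_def homogeneous_basis_axioms_def)
  show ?thesis
    unfolding Let_def
  proof (intro conjI allI impI ballI)
    fix J assume J: "J \<subseteq> lists I"
      and *: "inj_on monomial J \<and> maximal_independent sscale (monomial ` lists I) (monomial ` J)"
    interpret monomial_basis smul T V0 V1 I e \<phi> J
      using J * maximal_independent_spans[of "monomial ` lists I" "monomial ` J"]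
      by unfold_locales (auto simp: maximal_independent_def)
    show "absolute_schauder_basis sscale (sym_topology smul T V0 V1 R) J monomial \<psi>"
      unfolding sym_topology_family by (rule absolute_schauder_basis_monomials) simp
    show "absolute_schauder_basis sscale (weyl_minus_topology smul T V0 V1 R) J monomial \<psi>"
      unfolding weyl_minus_topology_family by (rule absolute_schauder_basis_monomials) simp
  qed (use degreewise_estimate in blast)+
qed

end
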